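(* Let $T>0$, $A\ge 0$, and let $b(y,t)$, $y\in\mathbb{R}$, $t\le T$, be a real-valued function, differentiable in $y$ with $\partial b/\partial y$ continuous in $(y,t)$, satisfying $\sup\{|\partial b(y,t)/\partial y| : y\in\mathbb{R},\ t\le T\}\le A$. Let $q_\varepsilon$ and $q$ be the functions defined in the context. Then for $x,y\in\mathbb{R}$, $t<T$, $0<\varepsilon<1$, there is a constant $C$ depending only on $x,y,t,T,A$ such that $$|q_\varepsilon(x,y,t)-q(x,y,t)|\le C\sqrt{\varepsilon}.$$
   Context: For $\varepsilon>0$, let $Y_\varepsilon$ be the solution of the stochastic differential equation $dY_\varepsilon(s)=b(Y_\varepsilon(s),s)\,ds+\sqrt{\varepsilon}\,dW(s)$, $t\le s\le T$, with $W$ Brownian motion. For $x,y\in\mathbb{R}$, $t<T$ put $u_\varepsilon(x,y,t)=P(Y_\varepsilon(T)>x \mid Y_\varepsilon(t)=y)$ (equivalently, $u_\varepsilon$ is the bounded solution of $\partial_t u_\varepsilon+b(y,t)\partial_y u_\varepsilon+\frac{\varepsilon}{2}\partial_y^2u_\varepsilon=0$, $y\in\mathbb{R}$, $t<T$, with limit as $t\to T$ equal to $0$ for $y<x$ and $1$ for $y>x$), and define $q_\varepsilon$ by $u_\varepsilon(x,y,t)=\exp[-q_\varepsilon(x,y,t)/\varepsilon]$. Let $$q(x,y,t)=\min\left\{\tfrac12\int_t^T\left[\tfrac{dy(s)}{ds}-b(y(s),s)\right]^2ds\right\},$$ the minimum being over all paths $y(s)=y+\int_t^s f(s')\,ds'$,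 $t\le s\le T$, with $f\in L^2[t,T]$ (so $y(t)=y$) and $y(T)\ge x$.
   Formalization: The constant C may depend on the L² norm of b(y,·) on [t,T] as well as on x,y,t,T,A (with b = −z constant, z→∞, no C independent of b exists), and b(y,·) is assumed measurable and square integrable on [t,T], without which q is infinite or undefined. *)

theory Defs
  imports "HOL-Probability.Probability"
begin

text \<open>A drift is a function \<open>b y s\<close> of position \<open>y\<close> and time \<open>s\<close>; only times \<open>s \<le> T\<close> matter.\<close>

definition drift_bound :: "(real \<Rightarrow> real \<Rightarrow> real) \<Rightarrow> real \<Rightarrow> real \<Rightarrow> bool" where
  "drift_bound b T A \<longleftrightarrow>
     (\<forall>y. \<forall>s\<le>T. (\<lambda>z. b z s) differentiable (at y)) \<and>
     continuous_on (UNIV \<times> {..T}) (\<lambda>(y, s). deriv (\<lambda>z. b z s) y) \<and>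
     (\<forall>y. \<forall>s\<le>T. \<bar>deriv (\<lambda>z. b z s) y\<bar> \<le> A)"

definition L2_on :: "real \<Rightarrow> real \<Rightarrow> (real \<Rightarrow> real) \<Rightarrow> bool" where
  "L2_on t T f \<longleftrightarrow>
     set_borel_measurable lborel {t..T} f \<and>
     set_integrable lborel {t..T} (\<lambda>s. (f s)\<^sup>2)"

definition L2_norm_on :: "real \<Rightarrow> real \<Rightarrow> (real \<Rightarrow> real) \<Rightarrow> real" where
  "L2_norm_on t T f = sqrt (LINT s:{t..T}|lborel. (f s)\<^sup>2)"

text \<open>Brownian motion is indexed by \<open>[t, T]\<close>, where \<open>t\<close> may be negative; it is described
  through its increments, so \<open>W t\<close> need not vanish.\<close>

definition brownian_motion_on ::
  "'a measure \<Rightarrow> real \<Rightarrow> real \<Rightarrow> (real \<Rightarrow> 'a \<Rightarrow> real) \<Rightarrow> bool" where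
  "brownian_motion_on M t T W \<longleftrightarrow>
     prob_space M \<and>
     (\<forall>s\<in>{t..T}. W s \<in> borel_measurable M) \<and>
     (AE \<omega> in M. continuous_on {t..T} (\<lambda>s. W s \<omega>)) \<and>
     (\<forall>r s. t \<le> r \<and> r < s \<and> s \<le> T \<longrightarrow>
        distributed M lborel (\<lambda>\<omega>. W s \<omega> - W r \<omega>) (normal_density 0 (sqrt (s - r)))) \<and>
     (\<forall>(\<tau> :: nat \<Rightarrow> real) n.
        (\<forall>i\<le>n. \<tau> i \<in> {t..T}) \<and> (\<forall>i<n. \<tau> i \<le> \<tau> (Suc i)) \<longrightarrow>
        prob_space.indep_vars M (\<lambda>_. borel) (\<lambda>i \<omega>. W (\<tau> (Suc i)) \<omega> - W (\<tau> i) \<omega>) {..<n})"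

text \<open>The noise is additive, so the equation
  \<open>dY(s) = b(Y(s), s) ds + sqrt \<epsilon> dW(s)\<close>, \<open>Y(t) = y\<close>, is the following pathwise integral
  equation and no stochastic integral is involved.\<close>

definition sde_solution ::
  "'a measure \<Rightarrow> (real \<Rightarrow> real \<Rightarrow> real) \<Rightarrow> real \<Rightarrow> real \<Rightarrow> real \<Rightarrow> real \<Rightarrow>
   (real \<Rightarrow> 'a \<Rightarrow> real) \<Rightarrow> (real \<Rightarrow> 'a \<Rightarrow> real) \<Rightarrow> bool" where
  "sde_solution M b \<epsilon> t T y W Y \<longleftrightarrow>
     (\<forall>s\<in>{t..T}. Y s \<in> borel_measurable M) \<and>
     (AE \<omega> in M.
        continuous_on {t..T} (\<lambda>s. Y s \<omega>) \<and>
        set_integrable lborel {t..T} (\<lambda>r. b (Y r \<omega>) r) \<and>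
        (\<forall>s\<in>{t..T}. Y s \<omega> =
           y + (LINT r:{t..s}|lborel. b (Y r \<omega>) r) + sqrt \<epsilon> * (W s \<omega> - W t \<omega>)))"

text \<open>For a solution \<open>Y\<close> started from \<open>y\<close> at time \<open>t\<close>, the value \<open>u_eps M Y T x\<close> is
  \<open>u\<^sub>\<epsilon>(x, y, t) = P(Y(T) > x | Y(t) = y)\<close>.\<close>

definition u_eps :: "'a measure \<Rightarrow> (real \<Rightarrow> 'a \<Rightarrow> real) \<Rightarrow> real \<Rightarrow> real \<Rightarrow> real" where
  "u_eps M Y T x = measure M {\<omega> \<in> space M. Y T \<omega> > x}"

text \<open>The description below is unspecified if \<open>u_eps\<close> is zero, so a bound on \<open>q_eps\<close> cannot
  hold merely by a totality convention such as \<open>ln 0 = 0\<close>.\<close>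

definition q_eps :: "'a measure \<Rightarrow> (real \<Rightarrow> 'a \<Rightarrow> real) \<Rightarrow> real \<Rightarrow> real \<Rightarrow> real \<Rightarrow> real" where
  "q_eps M Y \<epsilon> T x = (THE r. u_eps M Y T x = exp (- r / \<epsilon>))"

definition path_of :: "real \<Rightarrow> real \<Rightarrow> (real \<Rightarrow> real) \<Rightarrow> real \<Rightarrow> real" where
  "path_of y t f s = y + (LINT r:{t..s}|lborel. f r)"

text \<open>Along \<open>path_of y t f\<close> the velocity is \<open>f\<close> almost everywhere.\<close>

definition action ::
  "(real \<Rightarrow> real \<Rightarrow> real) \<Rightarrow> real \<Rightarrow> real \<Rightarrow> real \<Rightarrow> (real \<Rightarrow> real) \<Rightarrow> real" where
  "action b y t T f = (1/2) * (LINT s:{t..T}|lborel. (f s - b (path_of y t f s) s)\<^sup>2)"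

text \<open>If \<open>drift_bound b T A\<close> and \<open>L2_on t T (b y)\<close> hold, then every action below is the integral
  of an integrable function, and the infimum is over a nonempty set of nonnegative numbers.\<close>

definition q_cost ::
  "(real \<Rightarrow> real \<Rightarrow> real) \<Rightarrow> real \<Rightarrow> real \<Rightarrow> real \<Rightarrow> real \<Rightarrow> real" where
  "q_cost b T x y t = (INF f \<in> {f. L2_on t T f \<and> path_of y t f T \<ge> x}. action b y t T f)"

end

theory Submission imports Defs begin

text \<open>Write \<open>k = sqrt \<epsilon>\<close>, \<open>q\<close> for the value of the variational problem and \<open>u\<close> for the probability of
\<open>Y T > x\<close>; it must be shown that \<open>- \<epsilon> ln u\<close> is within \<open>O(k)\<close> of \<open>q\<close>. Because the noise is additive, the equation
holds path by path, and both halves of the estimate come from comparing the random path with a controlled path, whose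
action bounds \<open>q\<close> from above. Every probabilistic estimate is a Gaussian integral over finitely
many independent increments, followed by a limit along refining grids. The drift is controlled
through two facts: \<open>b\<close> is Lipschitz in space with constant \<open>A\<close>, and
\<open>b (\<phi> s) s - b y s\<close> is continuous in \<open>s\<close> along continuous \<open>\<phi>\<close>, so that
\<open>s \<mapsto> b (\<phi> s) s\<close> is square integrable as soon as \<open>b y\<close> is.

\<^bold>\<open>Upper bound on\<close> \<open>u\<close> (\<open>log_u_eps_upper_bound\<close>). Cut \<open>[t, T]\<close> into \<open>N\<close> blocks of length \<open>h\<close>, let \<open>w\<close> be
the piecewise linear interpolation of \<open>W - W t\<close> at the block ends and \<open>B = W - W t - w\<close> the
remaining bridges. The path \<open>Y - k B\<close> is absolutely continuous and ends at \<open>Y T\<close>; its velocity is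
\<open>b (Y s) s + k w'\<close>. So if \<open>Y T > x\<close> then it is a competitor in the variational problem, whence
\<open>q \<le> (\<epsilon>/2) ((1 + k) \<integral>w'\<^sup>2 + (1 + 1/k) A\<^sup>2 \<integral>B\<^sup>2)\<close>. By Chebyshev's exponential inequality
\<open>exp ((1 - k) q / \<epsilon>) u\<close> is at most the expectation of
\<open>exp ((1 - \<epsilon>)/2 \<integral>w'\<^sup>2 + A\<^sup>2/(2k) \<integral>B\<^sup>2)\<close>. The interpolation and the bridges are independent, as are the
blocks, so this is a product over blocks; Jensen's inequality reduces the bridge integral to the
value of the bridge at one fixed offset inside each block, and each factor is at most
\<open>sqrt (2/\<epsilon>)\<close> provided that \<open>A\<^sup>2 h\<^sup>2 \<le> 2 k\<close>. Thus \<open>N\<close> of order \<open>\<epsilon> powr (-1/4)\<close> suffices, and the loss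
\<open>\<epsilon> (N/2) ln (2/\<epsilon>)\<close> is of order \<open>k\<close>. Orthogonality of bridge and interpolation is what makes such
coarse blocks possible: with \<open>N\<close> of order \<open>1/k\<close> a logarithm would be lost.

\<^bold>\<open>Lower bound on\<close> \<open>u\<close> (\<open>u_eps_lower_bound\<close>). Take a nearly optimal control, add a constant of
order \<open>k\<close> so that its path overshoots \<open>x\<close> by a large multiple of \<open>k\<close>, and let \<open>v\<close> be its deviation
from the drift. If \<open>P = k (W - W t) - \<integral>v\<close> satisfies \<open>(1/(T - t)) \<integral>\<bar>P\<bar> + \<bar>P T\<bar> \<le> k m\<close> then
Gronwall's inequality puts \<open>Y T\<close> above \<open>x\<close>. The probability of that event is bounded below by a
change of measure for the increments of \<open>W\<close>: under the tilted weight the increments are centred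
at those of \<open>\<integral>v / k\<close>, so the weighted mass of the event is at least one half by Markov's
inequality, and on the event (intersected with one more linear constraint) the weight is at most
\<open>exp (K\<^sup>2/2 + K m)\<close>, where \<open>K\<^sup>2 = \<integral>v\<^sup>2 / \<epsilon>\<close> up to an error of order \<open>1/k\<close>. Since
\<open>\<epsilon> K m\<close> is of order \<open>k\<close>, this loses only \<open>O(k)\<close>.\<close>

section \<open>Drift, controls and cost\<close>
lemma drift_lipschitz:
  assumes "drift_bound b T A" "s \<le> T"
  shows "\<bar>b z s - b w s\<bar> \<le> A * \<bar>z - w\<bar>"
proof -
  have "norm (b z s - b w s) \<le> A * norm (z - w)"
  proof (rule field_differentiable_bound[OF convex_UNIV])
    fix u :: real
    have "(\<lambda>z. b z s) differentiable (at u)" using assms unfolding drift_bound_def by blast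
    then show "((\<lambda>z. b z s) has_field_derivative deriv (\<lambda>z. b z s) u) (at u within UNIV)"
      using DERIV_deriv_iff_real_differentiable by auto
    show "norm (deriv (\<lambda>z. b z s) u) \<le> A" using assms unfolding drift_bound_def by simp
  qed auto
  then show ?thesis by simp
qed

text \<open>The drift at a fixed point may be discontinuous in time, but its spatial increments are
continuous in time because they are integrals of the jointly continuous derivative.\<close>
lemma drift_increment_continuous_in_time:
  assumes "drift_bound b T A"
  shows "continuous_on {..T} (\<lambda>s. b z s - b y s)"
proof -
  have *: "continuous_on {..T} (\<lambda>s. b z s - b y s)" if "y \<le> z" for y z
  proof -
    have "continuous_on ({..T} \<times> cbox y z) (\<lambda>(s, w). deriv (\<lambda>z. b z s) w)"
    proof -
      have "continuous_on (UNIV \<times> {..T}) (\<lambda>(y, s). deriv (\<lambda>z. b z s) y)"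
        using assms unfolding drift_bound_def by blast
      then have "continuous_on ((\<lambda>(s, w). (w, s)) ` ({..T} \<times> cbox y z)) (\<lambda>(y, s). deriv (\<lambda>z. b z s) y)"
        by (rule continuous_on_subset) auto
      then have "continuous_on ({..T} \<times> cbox y z) ((\<lambda>(y, s). deriv (\<lambda>z. b z s) y) \<circ> (\<lambda>(s, w). (w, s)))"
        by (intro continuous_on_compose) (auto intro!: continuous_intros simp: split_beta)
      then show ?thesis by (simp add: o_def split_beta)
    qed
    then have c: "continuous_on {..T} (\<lambda>s. integral (cbox y z) (deriv (\<lambda>z. b z s)))"
      by (rule integral_continuous_on_param)
    have "integral (cbox y z) (deriv (\<lambda>z. b z s)) = b z s - b y s" if "s \<le> T" for s
    proof -
      have "(deriv (\<lambda>z. b z s) has_integral (b z s - b y s)) {y..z}"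
      proof (rule fundamental_theorem_of_calculus[OF \<open>y \<le> z\<close>])
        fix u
        have "(\<lambda>z. b z s) differentiable (at u)" using assms that unfolding drift_bound_def by blast
        then show "((\<lambda>z. b z s) has_vector_derivative deriv (\<lambda>z. b z s) u) (at u within {y..z})"
          using DERIV_deriv_iff_real_differentiable has_real_derivative_iff_has_vector_derivative
            has_vector_derivative_at_within by blast
      qed
      then show ?thesis by (simp add: integral_unique)
    qed
    then show ?thesis using c by (metis (no_types, lifting) atMost_iff continuous_on_cong)
  qed
  show ?thesis
  proof (cases "y \<le> z")
    case True then show ?thesis by (rule *)
  next
    case False
    then have "continuous_on {..T} (\<lambda>s. - (b y s - b z s))"
      by (intro continuous_on_minus *) simp
    then show ?thesis by simp
  qed
qed

lemma drift_increment_continuous_along_path: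
  assumes b: "drift_bound b T A" and \<phi>: "continuous_on {t..T} \<phi>"
  shows "continuous_on {t..T} (\<lambda>s. b (\<phi> s) s - b y s)"
  unfolding continuous_on_def
proof
  fix s0 assume s0: "s0 \<in> {t..T}"
  define F where "F = at s0 within {t..T}"
  have 1: "((\<lambda>s. b (\<phi> s0) s - b y s) \<longlongrightarrow> b (\<phi> s0) s0 - b y s0) F"
    using drift_increment_continuous_in_time[OF b] s0 unfolding continuous_on_def F_def
    by (meson Icc_subset_Iic_iff atLeastAtMost_iff atMost_iff order_refl tendsto_within_subset)
  have "((\<lambda>s. A * \<bar>\<phi> s - \<phi> s0\<bar>) \<longlongrightarrow> A * \<bar>\<phi> s0 - \<phi> s0\<bar>) F"
    using \<phi> s0 unfolding continuous_on_def F_def by (intro tendsto_intros) auto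
  then have 2: "((\<lambda>s. A * \<bar>\<phi> s - \<phi> s0\<bar>) \<longlongrightarrow> 0) F" by simp
  have "((\<lambda>s. b (\<phi> s) s - b (\<phi> s0) s) \<longlongrightarrow> 0) F"
  proof (rule Lim_null_comparison[OF _ 2])
    show "\<forall>\<^sub>F s in F. norm (b (\<phi> s) s - b (\<phi> s0) s) \<le> A * \<bar>\<phi> s - \<phi> s0\<bar>"
      unfolding F_def eventually_at_filter
      by (rule always_eventually) (auto intro!: drift_lipschitz[OF b])
  qed
  from tendsto_add[OF 1 this] 
  show "((\<lambda>s. b (\<phi> s) s - b y s) \<longlongrightarrow> b (\<phi> s0) s0 - b y s0) (at s0 within {t..T})"
    by (simp add: F_def)
qed

lemma set_integrable_continuous:
  fixes g :: "real \<Rightarrow> real"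
  assumes "continuous_on {t..T} g"
  shows "set_integrable lborel {t..T} g"
  using assms by (rule borel_integrable_atLeastAtMost')

lemma L2_on_continuous:
  assumes "continuous_on {t..T} g"
  shows "L2_on t T g"
  unfolding L2_on_def
proof
  show "set_borel_measurable lborel {t..T} g"
    using set_integrable_continuous[OF assms] unfolding set_integrable_def set_borel_measurable_def
    by (rule borel_measurable_integrable)
  show "set_integrable lborel {t..T} (\<lambda>s. (g s)\<^sup>2)"
    by (intro set_integrable_continuous continuous_intros assms)
qed

lemma set_integrable_bound_real:
  fixes f g :: "real \<Rightarrow> real"
  assumes "set_integrable lborel S f" "set_borel_measurable lborel S g"
    and "\<And>s. s \<in> S \<Longrightarrow> \<bar>g s\<bar> \<le> f s"
  shows "set_integrable lborel S g"
  using assms(1,2) by (rule set_integrable_bound) (use assms(3) in force)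

lemma set_borel_measurable_power2:
  fixes f :: "real \<Rightarrow> real"
  assumes "set_borel_measurable lborel S f"
  shows "set_borel_measurable lborel S (\<lambda>s. (f s)\<^sup>2)"
proof -
  have "(\<lambda>s. (indicator S s *\<^sub>R f s)\<^sup>2) \<in> borel_measurable lborel"
    using assms unfolding set_borel_measurable_def by measurable
  also have "(\<lambda>s. (indicator S s *\<^sub>R f s)\<^sup>2) = (\<lambda>s. indicator S s *\<^sub>R (f s)\<^sup>2)"
    by (auto simp: indicator_def)
  finally show ?thesis unfolding set_borel_measurable_def .
qed

lemma L2_on_add:
  assumes "L2_on t T f" "L2_on t T g"
  shows "L2_on t T (\<lambda>s. f s + g s)"
proof -
  have m: "set_borel_measurable lborel {t..T} (\<lambda>s. f s + g s)"
    using assms unfolding L2_on_def set_borel_measurable_def by (auto simp: distrib_left)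
  have "set_integrable lborel {t..T} (\<lambda>s. 2 * (f s)\<^sup>2 + 2 * (g s)\<^sup>2)"
    using assms unfolding L2_on_def by (intro set_integral_add set_integrable_mult_right) auto
  then have "set_integrable lborel {t..T} (\<lambda>s. (f s + g s)\<^sup>2)"
  proof (rule set_integrable_bound_real[OF _ set_borel_measurable_power2[OF m]])
    fix s
    have "(f s + g s)\<^sup>2 \<le> 2 * (f s)\<^sup>2 + 2 * (g s)\<^sup>2"
      using zero_le_power2[of "f s - g s"] unfolding power2_sum power2_diff by simp
    then show "\<bar>(f s + g s)\<^sup>2\<bar> \<le> 2 * (f s)\<^sup>2 + 2 * (g s)\<^sup>2" by simp
  qed
  then show ?thesis using m by (simp add: L2_on_def)
qed

lemma L2_on_minus: "L2_on t T f \<Longrightarrow> L2_on t T (\<lambda>s. - f s)"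
  unfolding L2_on_def set_borel_measurable_def by simp

lemma L2_on_diff: "L2_on t T f \<Longrightarrow> L2_on t T g \<Longrightarrow> L2_on t T (\<lambda>s. f s - g s)"
  using L2_on_add[OF _ L2_on_minus] by fastforce

lemma L2_on_imp_set_integrable:
  assumes "L2_on t T f"
  shows "set_integrable lborel {t..T} f"
proof (rule set_integrable_bound_real)
  show "set_integrable lborel {t..T} (\<lambda>s. 1 + (f s)\<^sup>2)"
    using assms unfolding L2_on_def by (intro set_integral_add) (auto intro: set_integrable_continuous)
  show "set_borel_measurable lborel {t..T} f" using assms by (simp add: L2_on_def)
  fix s
  have "0 \<le> (\<bar>f s\<bar> - 1)\<^sup>2" by simp
  then show "\<bar>f s\<bar> \<le> 1 + (f s)\<^sup>2" by (simp add: power2_eq_square algebra_simps)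
qed

lemma L2_on_drift_along_path:
  assumes "drift_bound b T A" "L2_on t T (b y)" "continuous_on {t..T} \<phi>"
  shows "L2_on t T (\<lambda>s. b (\<phi> s) s)"
  using L2_on_add[OF assms(2) L2_on_continuous[OF drift_increment_continuous_along_path[OF assms(1,3), where y = y]]]
  by simp

lemma continuous_on_indefinite_integral:
  fixes f :: "real \<Rightarrow> real"
  assumes "set_integrable lborel {t..T} f"
  shows "continuous_on {t..T} (\<lambda>s. LINT r:{t..s}|lborel. f r)"
proof -
  have "continuous_on {t..T} (\<lambda>s. integral {t..s} f)"
    by (rule indefinite_integral_continuous_1) (rule set_borel_integral_eq_integral(1)[OF assms])
  moreover have "(LINT r:{t..s}|lborel. f r) = integral {t..s} f" if "s \<in> {t..T}" for s
    by (rule set_borel_integral_eq_integral(2), rule set_integrable_subset[OF assms]) (use that in auto)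
  ultimately show ?thesis by (metis (no_types, lifting) continuous_on_cong)
qed

text \<open>The integral of \<open>f\<close> is \<open>0\<close> by convention if \<open>f\<close> is not integrable; the sign of \<open>g\<close> covers that case.\<close>
lemma set_integral_mono_nonneg:
  fixes f g :: "real \<Rightarrow> real"
  assumes "set_integrable lborel S g" "\<And>s. s \<in> S \<Longrightarrow> f s \<le> g s" "\<And>s. s \<in> S \<Longrightarrow> 0 \<le> g s"
  shows "(LINT s:S|lborel. f s) \<le> (LINT s:S|lborel. g s)"
  unfolding set_lebesgue_integral_def
  by (rule integral_mono') (use assms in \<open>auto simp: set_integrable_def indicator_def\<close>)

lemma q_cost_le_action:
  assumes "L2_on t T f" "x \<le> path_of y t f T"
  shows "q_cost b T x y t \<le> action b y t T f"
  unfolding q_cost_def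
proof (rule cINF_lower)
  show "bdd_below (action b y t T ` {f. L2_on t T f \<and> x \<le> path_of y t f T})"
    by (rule bdd_belowI2[where m = 0])
      (auto simp: action_def set_lebesgue_integral_def intro!: integral_nonneg_AE)
qed (use assms in auto)

text \<open>The constant velocity \<open>\<bar>x - y\<bar> / (T - t)\<close> reaches \<open>x\<close>, or overshoots it if \<open>x < y\<close>. It shows that the
variational problem is feasible and bounds its value.\<close>
lemma constant_control:
  assumes "t < T"
  shows "L2_on t T (\<lambda>_. \<bar>x - y\<bar> / (T - t))"
    "\<And>s. t \<le> s \<Longrightarrow> path_of y t (\<lambda>_. \<bar>x - y\<bar> / (T - t)) s = y + (s - t) * (\<bar>x - y\<bar> / (T - t))"
    "x \<le> path_of y t (\<lambda>_. \<bar>x - y\<bar> / (T - t)) T"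
proof -
  show "L2_on t T (\<lambda>_. \<bar>x - y\<bar> / (T - t))" by (rule L2_on_continuous) simp
  show *: "path_of y t (\<lambda>_. \<bar>x - y\<bar> / (T - t)) s = y + (s - t) * (\<bar>x - y\<bar> / (T - t))" if "t \<le> s" for s
    using that by (simp add: path_of_def set_lebesgue_integral_def)
  show "x \<le> path_of y t (\<lambda>_. \<bar>x - y\<bar> / (T - t)) T"
    using assms by (subst *) auto
qed

text \<open>A bound on \<open>q_cost\<close> in terms of \<open>\<rho> = L2_norm_on t T (b y)\<close>, obtained from the constant control.\<close>
definition cost_bound :: "real \<Rightarrow> real \<Rightarrow> real \<Rightarrow> real \<Rightarrow> real \<Rightarrow> real \<Rightarrow> real" where
  "cost_bound A x y t T \<rho> = (\<bar>x - y\<bar> / (T - t) * (1 + A * (T - t)))\<^sup>2 * (T - t) + \<rho>\<^sup>2"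

lemma q_cost_nonneg:
  assumes "t < T" shows "0 \<le> q_cost b T x y t"
  unfolding q_cost_def
proof (rule cINF_greatest)
  show "{f. L2_on t T f \<and> path_of y t f T \<ge> x} \<noteq> {}"
    using constant_control(1,3)[OF assms, where x = x and y = y] by blast
qed (auto simp: action_def set_lebesgue_integral_def intro!: integral_nonneg_AE)

lemma q_cost_le_cost_bound:
  assumes b: "drift_bound b T A" and by2: "L2_on t T (b y)" and "t < T" "0 \<le> A"
  shows "q_cost b T x y t \<le> cost_bound A x y t T (L2_norm_on t T (b y))"
proof -
  define \<tau> where "\<tau> = T - t"
  define k where "k = \<bar>x - y\<bar> / \<tau>"
  define g where "g = (\<lambda>_::real. k)"
  note cc = constant_control[OF \<open>t < T\<close>, where x = x and y = y, folded \<tau>_def, folded k_def, folded g_def]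
  have \<tau>: "0 < \<tau>" and k: "0 \<le> k" using assms by (auto simp: \<tau>_def k_def)
  have i1: "set_integrable lborel {t..T} (\<lambda>s. (b y s)\<^sup>2)" using by2 by (simp add: L2_on_def)
  have i2: "set_integrable lborel {t..T} (\<lambda>s. (k * (1 + A * \<tau>))\<^sup>2)"
    by (intro set_integrable_continuous continuous_intros)
  have "(LINT s:{t..T}|lborel. (g s - b (path_of y t g s) s)\<^sup>2)
     \<le> (LINT s:{t..T}|lborel. 2 * (k * (1 + A * \<tau>))\<^sup>2 + 2 * (b y s)\<^sup>2)"
  proof (rule set_integral_mono_nonneg)
    fix s assume s: "s \<in> {t..T}"
    have "\<bar>b (path_of y t g s) s - b y s\<bar> \<le> A * \<bar>path_of y t g s - y\<bar>"
      by (rule drift_lipschitz[OF b]) (use s in auto)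
    also have "\<dots> \<le> A * (\<tau> * k)"
      using s k \<open>0 \<le> A\<close> cc(2)[of s] by (auto simp: \<tau>_def abs_mult intro!: mult_left_mono mult_right_mono)
    finally have "\<bar>g s - b (path_of y t g s) s\<bar> \<le> k * (1 + A * \<tau>) + \<bar>b y s\<bar>"
      using k by (simp add: g_def algebra_simps)
    then have "(g s - b (path_of y t g s) s)\<^sup>2 \<le> (k * (1 + A * \<tau>) + \<bar>b y s\<bar>)\<^sup>2"
      using abs_le_square_iff by fastforce
    also have "\<dots> \<le> 2 * (k * (1 + A * \<tau>))\<^sup>2 + 2 * \<bar>b y s\<bar>\<^sup>2"
      using zero_le_power2[of "k * (1 + A * \<tau>) - \<bar>b y s\<bar>"] by (simp only: power2_sum power2_diff)
    finally show "(g s - b (path_of y t g s) s)\<^sup>2 \<le> 2 * (k * (1 + A * \<tau>))\<^sup>2 + 2 * (b y s)\<^sup>2" by simp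
  qed (use i1 i2 in \<open>auto intro!: set_integral_add set_integrable_mult_right\<close>)
  also have "\<dots> = 2 * ((k * (1 + A * \<tau>))\<^sup>2 * \<tau>) + 2 * (LINT s:{t..T}|lborel. (b y s)\<^sup>2)"
    using i1 i2 \<tau> by (subst set_integral_add) (auto intro!: set_integrable_mult_right simp: set_lebesgue_integral_def \<tau>_def)
  finally have "action b y t T g \<le> (k * (1 + A * \<tau>))\<^sup>2 * \<tau> + (LINT s:{t..T}|lborel. (b y s)\<^sup>2)"
    by (simp add: action_def)
  also have "(LINT s:{t..T}|lborel. (b y s)\<^sup>2) = (L2_norm_on t T (b y))\<^sup>2"
    unfolding L2_norm_on_def by (subst real_sqrt_pow2)
      (auto simp: set_lebesgue_integral_def intro!: integral_nonneg_AE)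
  finally show ?thesis
    using q_cost_le_action[OF cc(1,3), of b] by (simp add: cost_bound_def \<tau>_def k_def)
qed

section \<open>Riemann sums, Gronwall's inequality and energy of increments\<close>
lemma riemann_cell:
  fixes g :: "real \<Rightarrow> real"
  assumes g: "continuous_on {a..b} g" and ab: "a \<le> b"
    and e: "\<And>u v. u \<in> {a..b} \<Longrightarrow> v \<in> {a..b} \<Longrightarrow> \<bar>g u - g v\<bar> \<le> e" and p: "p \<in> {a..b}"
  shows "\<bar>integral {a..b} g - (b - a) * g p\<bar> \<le> e * (b - a)"
proof -
  have gi: "g integrable_on {a..b}" using g by (rule integrable_continuous_interval)
  have "integral {a..b} g - (b - a) * g p = integral {a..b} (\<lambda>u. g u - g p)"
    using ab gi by (subst integral_diff) (auto simp: integrable_const_ivl)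
  moreover have "norm (integral {a..b} (\<lambda>u. g u - g p)) \<le> e * (b - a)"
    using ab p by (intro integral_bound continuous_intros g) (auto intro!: e)
  ultimately show ?thesis by simp
qed

lemma integral_uniform_grid:
  fixes g :: "real \<Rightarrow> real"
  assumes "continuous_on {a..b} g" "0 < h" "a + real n * h \<le> b"
  shows "integral {a..a + real n * h} g = (\<Sum>k<n. integral {a + real k * h..a + real (Suc k) * h} g)"
  using assms(3)
proof (induction n)
  case (Suc n)
  have le: "a + real n * h \<le> a + real (Suc n) * h" "a \<le> a + real n * h"
    using \<open>0 < h\<close> by (auto simp: algebra_simps)
  have "integral {a..a + real n * h} g + integral {a + real n * h..a + real (Suc n) * h} g
      = integral {a..a + real (Suc n) * h} g"
    using le Suc.prems
    by (intro Henstock_Kurzweil_Integration.integral_combine integrable_continuous_interval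
        continuous_on_subset[OF assms(1)]) auto
  then show ?case using Suc le by simp
qed simp

text \<open>The tag offset \<open>c\<close> is a parameter because the two bounds use different tags: left end points for
the random walk, midpoints for the bridges.\<close>
lemma riemann_sums_tendsto_integral:
  fixes g :: "real \<Rightarrow> real"
  assumes g: "continuous_on {a..b} g" and ab: "a < b" and c: "0 \<le> c" "c \<le> 1"
  shows "(\<lambda>n. (b - a) / n * (\<Sum>k<n. g (a + (real k + c) * ((b - a) / n)))) \<longlonglongrightarrow> (LINT s:{a..b}|lborel. g s)"
proof -
  have I: "(LINT s:{a..b}|lborel. g s) = integral {a..b} g"
    by (intro set_borel_integral_eq_integral set_integrable_continuous g)
  show ?thesis unfolding I
  proof (rule LIMSEQ_I)
    fix r :: real assume r: "0 < r"
    define e where "e = r / 2 / (b - a)"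
    have e: "0 < e" using r ab by (simp add: e_def)
    have "uniformly_continuous_on {a..b} g"
      using g by (rule compact_uniformly_continuous) simp
    then obtain d where d: "0 < d" "\<And>u v. u \<in> {a..b} \<Longrightarrow> v \<in> {a..b} \<Longrightarrow> \<bar>u - v\<bar> < d \<Longrightarrow> \<bar>g u - g v\<bar> < e"
      unfolding uniformly_continuous_on_def dist_real_def using e by metis
    obtain N :: nat where N: "(b - a) / d < N" using reals_Archimedean2 by blast
    have "norm ((b - a) / n * (\<Sum>k<n. g (a + (real k + c) * ((b - a) / n))) - integral {a..b} g) < r" if n: "n \<ge> Suc N" for n
    proof -
      define h where "h = (b - a) / n"
      have h: "0 < h" "real n * h = b - a" using n ab by (auto simp: h_def)
      have "(b - a) / d < n" using N n by linarith
      then have hd: "h < d" using n d by (simp add: h_def field_simps)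
      have cell: "\<bar>integral {a + real k * h..a + real (Suc k) * h} g - h * g (a + (real k + c) * h)\<bar> \<le> e * h"
        if k: "k < n" for k
      proof -
        have "real (Suc k) * h \<le> real n * h" using h k by (intro mult_right_mono) auto
        then have sub: "{a + real k * h..a + real (Suc k) * h} \<subseteq> {a..b}" using h by auto
        have "\<bar>integral {a + real k * h..a + real (Suc k) * h} g
            - (a + real (Suc k) * h - (a + real k * h)) * g (a + (real k + c) * h)\<bar>
            \<le> e * (a + real (Suc k) * h - (a + real k * h))"
        proof (rule riemann_cell)
          show "continuous_on {a + real k * h..a + real (Suc k) * h} g"
            using g sub by (rule continuous_on_subset)
          show "a + (real k + c) * h \<in> {a + real k * h..a + real (Suc k) * h}"
            using h c by (auto simp: algebra_simps)
          fix u v assume uv: "u \<in> {a + real k * h..a + real (Suc k) * h}" "v \<in> {a + real k * h..a + real (Suc k) * h}"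
          then have "\<bar>u - v\<bar> \<le> h" by (auto simp: algebra_simps abs_le_iff)
          then show "\<bar>g u - g v\<bar> \<le> e" using d(2)[of u v] uv sub hd by (meson less_eq_real_def order_le_less_trans subsetD)
        qed (use h in \<open>auto simp: algebra_simps\<close>)
        then show ?thesis by (simp add: algebra_simps)
      qed
      have "integral {a..b} g = (\<Sum>k<n. integral {a + real k * h..a + real (Suc k) * h} g)"
        using integral_uniform_grid[OF g h(1), of n] h(2) by simp
      then have "\<bar>integral {a..b} g - (\<Sum>k<n. h * g (a + (real k + c) * h))\<bar>
          = \<bar>\<Sum>k<n. integral {a + real k * h..a + real (Suc k) * h} g - h * g (a + (real k + c) * h)\<bar>"
        by (simp add: sum_subtractf)
      also have "\<dots> \<le> (\<Sum>k<n. e * h)"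
        by (rule order_trans[OF sum_abs sum_mono]) (use cell in auto)
      also have "\<dots> = e * (real n * h)" by simp
      also have "\<dots> = e * (b - a)" unfolding h(2) ..
      also have "e * (b - a) = r / 2"
        using nonzero_mult_div_cancel_right[of "b - a" "r / 2"] ab by (simp add: e_def)
      also have "r / 2 < r" using r by simp
      finally show ?thesis
        unfolding h_def[symmetric] sum_distrib_left by (simp add: abs_minus_commute)
    qed
    then show "\<exists>no. \<forall>n\<ge>no. norm ((b - a) / n * (\<Sum>k<n. g (a + (real k + c) * ((b - a) / n))) - integral {a..b} g) < r"
      by blast
  qed
qed

text \<open>The perturbation \<open>P\<close> enters through its integral rather than its supremum: for a Brownian path the
integral is controlled by moments at single times. With \<open>\<Psi>\<close> the integral of \<open>\<bar>D - P\<bar> + \<bar>P\<bar>\<close>, the assumptions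
give \<open>\<bar>D - P\<bar> \<le> A \<Psi>\<close>, hence \<open>\<Psi>' \<le> A \<Psi> + \<bar>P\<bar>\<close>, and the integrating factor finishes the proof.\<close>
lemma gronwall_linear_perturbation:
  fixes D P \<alpha> :: "real \<Rightarrow> real"
  assumes P: "continuous_on {t..T} P" and tT: "t < T" and A: "0 \<le> A"
    and D: "continuous_on {t..T} D"
    and \<alpha>: "set_integrable lborel {t..T} \<alpha>" "\<And>s. s \<in> {t..T} \<Longrightarrow> \<bar>\<alpha> s\<bar> \<le> A * \<bar>D s\<bar>"
    and eq: "\<And>s. s \<in> {t..T} \<Longrightarrow> D s = (LINT r:{t..s}|lborel. \<alpha> r) + P s"
  shows "\<bar>D T - P T\<bar> \<le> A * exp (A * (T - t)) * (LINT s:{t..T}|lborel. \<bar>P s\<bar>)"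
proof -
  define g where "g = (\<lambda>s. \<bar>D s - P s\<bar> + \<bar>P s\<bar>)"
  define \<Psi> where "\<Psi> = (\<lambda>s. integral {t..s} g)"
  define Q where "Q = (\<lambda>s. integral {t..s} (\<lambda>s. \<bar>P s\<bar>))"
  have gc: "continuous_on {t..T} g" and Pc: "continuous_on {t..T} (\<lambda>s. \<bar>P s\<bar>)"
    unfolding g_def by (intro continuous_intros P D)+
  have bound: "\<bar>D s - P s\<bar> \<le> A * \<Psi> s" if s: "s \<in> {t..T}" for s
  proof -
    have sub: "{t..s} \<subseteq> {t..T}" using s by auto
    have \<alpha>s: "set_integrable lborel {t..s} \<alpha>"
      by (rule set_integrable_subset[OF \<alpha>(1)]) (use sub in auto)
    have Ag: "continuous_on {t..s} (\<lambda>r. A * g r)"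
      by (intro continuous_intros continuous_on_subset[OF gc sub])
    have "D s - P s = (LINT r:{t..s}|lborel. \<alpha> r)" using eq[OF s] by simp
    then have "\<bar>D s - P s\<bar> = norm (integral {t..s} \<alpha>)"
      using set_borel_integral_eq_integral(2)[OF \<alpha>s] by simp
    also have "\<dots> \<le> integral {t..s} (\<lambda>r. A * g r)"
    proof (rule integral_norm_bound_integral)
      show "\<alpha> integrable_on {t..s}" using set_borel_integral_eq_integral(1)[OF \<alpha>s] .
      show "(\<lambda>r. A * g r) integrable_on {t..s}" using Ag by (rule integrable_continuous_interval)
      fix r assume "r \<in> {t..s}"
      then have "\<bar>\<alpha> r\<bar> \<le> A * \<bar>D r\<bar>" using sub \<alpha>(2) by auto
      also have "\<dots> \<le> A * g r" unfolding g_def using A by (intro mult_left_mono) auto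
      finally show "norm (\<alpha> r) \<le> A * g r" by simp
    qed
    finally show ?thesis by (simp add: \<Psi>_def)
  qed
  define G where "G = (\<lambda>s. exp (- A * (s - t)) * \<Psi> s - Q s)"
  have Q\<Psi>: "continuous_on {t..T} \<Psi>" "continuous_on {t..T} Q"
    unfolding \<Psi>_def Q_def
    by (intro indefinite_integral_continuous_1 integrable_continuous_interval gc Pc)+
  have "G T \<le> G t"
  proof (rule DERIV_nonpos_imp_decreasing_open[of t T G])
    show "continuous_on {t..T} G" unfolding G_def by (intro continuous_intros Q\<Psi>)
    fix s assume s: "t < s" "s < T"
    have at: "at s within {t..T} = at s" using s by (simp add: at_within_Icc_at)
    have d1: "(\<Psi> has_real_derivative g s) (at s)"
      using integral_has_real_derivative[OF gc, of s] s at by (simp add: \<Psi>_def)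
    have d2: "(Q has_real_derivative \<bar>P s\<bar>) (at s)"
      using integral_has_real_derivative[OF Pc, of s] s at by (simp add: Q_def)
    have "(G has_real_derivative exp (- A * (s - t)) * (g s - A * \<Psi> s) - \<bar>P s\<bar>) (at s)"
      unfolding G_def by (auto intro!: derivative_eq_intros d1 d2 simp: algebra_simps)
    moreover have "exp (- A * (s - t)) * (g s - A * \<Psi> s) \<le> 1 * \<bar>P s\<bar>"
    proof -
      have "exp (- A * (s - t)) * (g s - A * \<Psi> s) \<le> exp (- A * (s - t)) * \<bar>P s\<bar>"
        using bound[of s] s by (intro mult_left_mono) (auto simp: g_def)
      also have "\<dots> \<le> 1 * \<bar>P s\<bar>" using A s by (intro mult_right_mono) auto
      finally show ?thesis .
    qed
    ultimately show "\<exists>y. (G has_real_derivative y) (at s) \<and> y \<le> 0" by force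
  qed (use tT in simp)
  then have "exp (- (A * (T - t))) * \<Psi> T \<le> Q T" by (simp add: G_def \<Psi>_def Q_def)
  then have "exp (A * (T - t)) * (exp (- (A * (T - t))) * \<Psi> T) \<le> exp (A * (T - t)) * Q T"
    by (rule mult_left_mono) simp
  then have "\<Psi> T \<le> exp (A * (T - t)) * Q T" by (simp add: mult.assoc[symmetric] exp_add[symmetric])
  then have "A * \<Psi> T \<le> A * exp (A * (T - t)) * Q T" using A by (simp add: mult_left_mono mult.assoc)
  moreover have "Q T = (LINT s:{t..T}|lborel. \<bar>P s\<bar>)"
    unfolding Q_def by (rule set_borel_integral_eq_integral(2)[symmetric]) (rule set_integrable_continuous[OF Pc])
  ultimately show ?thesis using bound[of T] tT by simp
qed

text \<open>The integral of \<open>(v - m)\<^sup>2\<close> over \<open>{t..s}\<close> increases with \<open>s\<close>; with \<open>m\<close> the mean of \<open>v\<close> over \<open>{a..c}\<close>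
this is the Cauchy-Schwarz inequality on that interval, in a form whose right side telescopes.\<close>
lemma cauchy_schwarz_increment:
  fixes v :: "real \<Rightarrow> real"
  assumes v: "L2_on t T v" and st: "t \<le> a" "a < c" "c \<le> T"
  defines "H \<equiv> \<lambda>s. LINT r:{t..s}|lborel. v r" and "F \<equiv> \<lambda>s. LINT r:{t..s}|lborel. (v r)\<^sup>2"
  shows "(H c - H a)\<^sup>2 / (c - a) \<le> F c - F a"
proof -
  define m where "m = (H c - H a) / (c - a)"
  have int: "set_integrable lborel {t..s} v" "set_integrable lborel {t..s} (\<lambda>r. (v r)\<^sup>2)"
    "set_integrable lborel {t..s} (\<lambda>r. m\<^sup>2)"
    if "s \<le> T" for s
    using v L2_on_imp_set_integrable[OF v] that unfolding L2_on_def
    by (auto elim!: set_integrable_subset intro: set_integrable_continuous)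
  have expand: "(v r - m)\<^sup>2 = (v r)\<^sup>2 - 2 * m * v r + m\<^sup>2" for r by (simp add: power2_diff)
  have J: "set_integrable lborel {t..s} (\<lambda>r. (v r - m)\<^sup>2)
      \<and> (LINT r:{t..s}|lborel. (v r - m)\<^sup>2) = F s - 2 * m * H s + m\<^sup>2 * (s - t)"
    if "t \<le> s" "s \<le> T" for s
    unfolding expand using int[OF that(2)] that
    by (simp add: set_integral_add set_integral_diff set_integrable_mult_right H_def F_def)
      (simp add: set_lebesgue_integral_def)
  have "(LINT r:{t..a}|lborel. (v r - m)\<^sup>2) \<le> (LINT r:{t..c}|lborel. (v r - m)\<^sup>2)"
  proof -
    have "(LINT r:{t..a}|lborel. (v r - m)\<^sup>2) = integral {t..a} (\<lambda>r. (v r - m)\<^sup>2)"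
      "(LINT r:{t..c}|lborel. (v r - m)\<^sup>2) = integral {t..c} (\<lambda>r. (v r - m)\<^sup>2)"
      using conjunct1[OF J[of a]] conjunct1[OF J[of c]] st by (auto intro!: set_borel_integral_eq_integral(2))
    moreover have "integral {t..a} (\<lambda>r. (v r - m)\<^sup>2) \<le> integral {t..c} (\<lambda>r. (v r - m)\<^sup>2)"
      using J[of a] J[of c] st
      by (intro integral_subset_le set_borel_integral_eq_integral(1)) auto
    ultimately show ?thesis by simp
  qed
  then have "F a - 2 * m * H a + m\<^sup>2 * (a - t) \<le> F c - 2 * m * H c + m\<^sup>2 * (c - t)"
    using J[of a] J[of c] st by simp
  then have "2 * m * (H c - H a) - m\<^sup>2 * (c - a) \<le> F c - F a" by (simp add: algebra_simps)
  moreover have "2 * m * (H c - H a) - m\<^sup>2 * (c - a) = (H c - H a)\<^sup>2 / (c - a)"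
  proof -
    have "m * (c - a) = H c - H a" using st by (simp add: m_def)
    then have "2 * m * (H c - H a) - m\<^sup>2 * (c - a) = 2 * m * (H c - H a) - m * (H c - H a)"
      by (simp add: power2_eq_square)
    then show ?thesis by (simp add: m_def power2_eq_square)
  qed
  ultimately show ?thesis by simp
qed

lemma sum_squared_increments_le:
  fixes v :: "real \<Rightarrow> real"
  assumes v: "L2_on t T v" and tT: "t < T" and n: "0 < n"
  defines "H \<equiv> \<lambda>s. LINT r:{t..s}|lborel. v r" and "h \<equiv> (T - t) / real n"
  shows "(\<Sum>i<n. (H (t + real (Suc i) * h) - H (t + real i * h))\<^sup>2 / h) \<le> (LINT r:{t..T}|lborel. (v r)\<^sup>2)"
proof -
  define F where "F = (\<lambda>s. LINT r:{t..s}|lborel. (v r)\<^sup>2)"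
  have h: "0 < h" "real n * h = T - t" using tT n by (auto simp: h_def)
  have "(\<Sum>i<n. (H (t + real (Suc i) * h) - H (t + real i * h))\<^sup>2 / h)
      \<le> (\<Sum>i<n. F (t + real (Suc i) * h) - F (t + real i * h))"
  proof (rule sum_mono)
    fix i assume "i \<in> {..<n}"
    then have "real (Suc i) * h \<le> real n * h" using h by (intro mult_right_mono) auto
    then have "t + real (Suc i) * h \<le> T" using h by simp
    moreover have "t + real (Suc i) * h - (t + real i * h) = h" by (simp add: algebra_simps)
    ultimately show "(H (t + real (Suc i) * h) - H (t + real i * h))\<^sup>2 / h
        \<le> F (t + real (Suc i) * h) - F (t + real i * h)"
      using cauchy_schwarz_increment[OF v, of "t + real i * h" "t + real (Suc i) * h"] h
      by (simp add: H_def F_def)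
  qed
  also have "\<dots> = F (t + real n * h) - F (t + real 0 * h)"
    by (rule sum_lessThan_telescope[of "\<lambda>i. F (t + real i * h)"])
  also have "\<dots> \<le> F T"
    using h by (auto simp: F_def set_lebesgue_integral_def intro!: integral_nonneg_AE)
  finally show ?thesis by (simp add: F_def)
qed

section \<open>Tilting independent Gaussian increments\<close>
lemma nn_integral_normal_density_eq_1:
  "0 < \<sigma> \<Longrightarrow> (\<integral>\<^sup>+x. ennreal (normal_density \<mu> \<sigma> x) \<partial>lborel) = 1"
  using prob_space.emeasure_space_1[OF prob_space_normal_density, of \<sigma> \<mu>]
  by (simp add: emeasure_density)

lemma nn_integral_exp_linear_normal:
  assumes X: "distributed M lborel X (normal_density 0 \<sigma>)" and \<sigma>: "0 < \<sigma>"
  shows "(\<integral>\<^sup>+\<omega>. ennreal (exp (a * X \<omega>)) \<partial>M) = ennreal (exp (\<sigma>\<^sup>2 * a\<^sup>2 / 2))"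
proof -
  have eq: "normal_density 0 \<sigma> x * exp (a * x) = exp (\<sigma>\<^sup>2 * a\<^sup>2 / 2) * normal_density (a * \<sigma>\<^sup>2) \<sigma> x" for x
  proof -
    have "- x\<^sup>2 / (2 * \<sigma>\<^sup>2) + a * x = \<sigma>\<^sup>2 * a\<^sup>2 / 2 + - (x - a * \<sigma>\<^sup>2)\<^sup>2 / (2 * \<sigma>\<^sup>2)"
      using \<sigma> by (simp add: field_simps power2_eq_square)
    then have "exp (- x\<^sup>2 / (2 * \<sigma>\<^sup>2)) * exp (a * x) = exp (\<sigma>\<^sup>2 * a\<^sup>2 / 2) * exp (- (x - a * \<sigma>\<^sup>2)\<^sup>2 / (2 * \<sigma>\<^sup>2))"
      by (simp only: exp_add[symmetric])
    then show ?thesis by (simp add: normal_density_def)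
  qed
  have "(\<integral>\<^sup>+\<omega>. ennreal (exp (a * X \<omega>)) \<partial>M) = (\<integral>\<^sup>+x. ennreal (normal_density 0 \<sigma> x) * ennreal (exp (a * x)) \<partial>lborel)"
    by (rule distributed_nn_integral[OF X, symmetric]) simp
  also have "\<dots> = (\<integral>\<^sup>+x. ennreal (exp (\<sigma>\<^sup>2 * a\<^sup>2 / 2)) * ennreal (normal_density (a * \<sigma>\<^sup>2) \<sigma> x) \<partial>lborel)"
    by (simp add: ennreal_mult[symmetric] eq)
  also have "\<dots> = ennreal (exp (\<sigma>\<^sup>2 * a\<^sup>2 / 2))"
    using \<sigma> by (simp add: nn_integral_cmult nn_integral_normal_density_eq_1)
  finally show ?thesis .
qed

lemma nn_integral_exp_quadratic_normal:
  assumes \<sigma>: "0 < \<sigma>" and l: "0 < l"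
  shows "(\<integral>\<^sup>+x. ennreal (normal_density 0 \<sigma> x) * ennreal (exp ((1 - l) * x\<^sup>2 / (2 * \<sigma>\<^sup>2))) \<partial>lborel) = ennreal (1 / sqrt l)"
proof -
  have eq: "normal_density 0 \<sigma> x * exp ((1 - l) * x\<^sup>2 / (2 * \<sigma>\<^sup>2)) = 1 / sqrt l * normal_density 0 (\<sigma> / sqrt l) x" for x
  proof -
    have "- x\<^sup>2 / (2 * \<sigma>\<^sup>2) + (1 - l) * x\<^sup>2 / (2 * \<sigma>\<^sup>2) = - x\<^sup>2 / (2 * (\<sigma> / sqrt l)\<^sup>2)"
      using \<sigma> l by (simp add: field_simps)
    then have "exp (- x\<^sup>2 / (2 * \<sigma>\<^sup>2)) * exp ((1 - l) * x\<^sup>2 / (2 * \<sigma>\<^sup>2)) = exp (- x\<^sup>2 / (2 * (\<sigma> / sqrt l)\<^sup>2))"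
      by (simp only: exp_add[symmetric])
    moreover have "1 / sqrt (2 * pi * \<sigma>\<^sup>2) = 1 / sqrt l * (1 / sqrt (2 * pi * (\<sigma> / sqrt l)\<^sup>2))"
      using \<sigma> l by (simp add: real_sqrt_mult real_sqrt_divide power_divide)
    ultimately show ?thesis by (simp add: normal_density_def)
  qed
  have "(\<integral>\<^sup>+x. ennreal (normal_density 0 \<sigma> x) * ennreal (exp ((1 - l) * x\<^sup>2 / (2 * \<sigma>\<^sup>2))) \<partial>lborel)
      = (\<integral>\<^sup>+x. ennreal (1 / sqrt l) * ennreal (normal_density 0 (\<sigma> / sqrt l) x) \<partial>lborel)"
    using l by (simp add: ennreal_mult[symmetric] eq)
  also have "\<dots> = ennreal (1 / sqrt l)"
    using \<sigma> l by (subst nn_integral_cmult) (simp_all add: nn_integral_normal_density_eq_1)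
  finally show ?thesis .
qed

lemma (in prob_space) nn_integral_exp_linear_indep_normal:
  fixes \<xi> :: "'i \<Rightarrow> 'a \<Rightarrow> real"
  assumes ind: "indep_vars (\<lambda>_. borel) \<xi> I" and fin: "finite I" and \<sigma>: "0 < \<sigma>"
    and dist: "\<And>i. i \<in> I \<Longrightarrow> distributed M lborel (\<xi> i) (normal_density 0 \<sigma>)"
  shows "(\<integral>\<^sup>+\<omega>. ennreal (exp (\<Sum>i\<in>I. a i * \<xi> i \<omega>)) \<partial>M) = ennreal (exp (\<sigma>\<^sup>2 * (\<Sum>i\<in>I. (a i)\<^sup>2) / 2))"
proof -
  have ind': "indep_vars (\<lambda>_. borel) (\<lambda>i \<omega>. ennreal (exp (a i * \<xi> i \<omega>))) I"
    using ind by (rule indep_vars_compose2) simp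
  have "(\<integral>\<^sup>+\<omega>. ennreal (exp (\<Sum>i\<in>I. a i * \<xi> i \<omega>)) \<partial>M) = (\<integral>\<^sup>+\<omega>. (\<Prod>i\<in>I. ennreal (exp (a i * \<xi> i \<omega>))) \<partial>M)"
    by (simp add: exp_sum[OF fin] prod_ennreal)
  also have "\<dots> = (\<Prod>i\<in>I. \<integral>\<^sup>+\<omega>. ennreal (exp (a i * \<xi> i \<omega>)) \<partial>M)"
    by (rule indep_vars_nn_integral[OF fin ind']) simp
  also have "\<dots> = (\<Prod>i\<in>I. ennreal (exp (\<sigma>\<^sup>2 * (a i)\<^sup>2 / 2)))"
    by (rule prod.cong[OF refl]) (rule nn_integral_exp_linear_normal[OF dist \<sigma>])
  also have "\<dots> = ennreal (exp (\<sigma>\<^sup>2 * (\<Sum>i\<in>I. (a i)\<^sup>2) / 2))"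
    by (simp add: prod_ennreal exp_sum[OF fin, symmetric] sum_distrib_left sum_divide_distrib)
  finally show ?thesis .
qed

text \<open>The finite-dimensional Cameron-Martin formula, on the level of exponential moments: \<open>L\<close> is the
density that moves the means of the \<open>\<xi> i\<close> to \<open>c i\<close>, so under the weight \<open>L\<close> the differences
\<open>\<xi> i - c i\<close> have the joint moment generating function of centred Gaussians.\<close>
lemma (in prob_space) tilted_exp_moment:
  fixes \<xi> :: "'i \<Rightarrow> 'a \<Rightarrow> real" and c :: "'i \<Rightarrow> real"
  assumes ind: "indep_vars (\<lambda>_. borel) \<xi> I" and fin: "finite I" and h: "0 < h"
    and dist: "\<And>i. i \<in> I \<Longrightarrow> distributed M lborel (\<xi> i) (normal_density 0 (sqrt h))"
  defines "L \<equiv> \<lambda>\<omega>. exp ((\<Sum>i\<in>I. c i * \<xi> i \<omega>) / h - (\<Sum>i\<in>I. (c i)\<^sup>2) / (2 * h))"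
  shows "(\<integral>\<^sup>+\<omega>. ennreal (L \<omega> * exp (\<Sum>i\<in>I. a i * (\<xi> i \<omega> - c i))) \<partial>M) = ennreal (exp (h * (\<Sum>i\<in>I. (a i)\<^sup>2) / 2))"
proof -
  have rv: "\<xi> i \<in> borel_measurable M" if "i \<in> I" for i
    using ind that by (auto simp: indep_vars_def)
  define r where "r = - (\<Sum>i\<in>I. (c i)\<^sup>2 / (2 * h) + a i * c i)"
  have "(\<Sum>i\<in>I. c i * \<xi> i \<omega>) / h - (\<Sum>i\<in>I. (c i)\<^sup>2) / (2 * h) + (\<Sum>i\<in>I. a i * (\<xi> i \<omega> - c i))
      = r + (\<Sum>i\<in>I. (c i / h + a i) * \<xi> i \<omega>)" for \<omega>
    unfolding r_def sum_divide_distrib sum_negf[symmetric] sum.distrib[symmetric] sum_subtractf[symmetric]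
    by (rule sum.cong) (auto simp: algebra_simps)
  then have "L \<omega> * exp (\<Sum>i\<in>I. a i * (\<xi> i \<omega> - c i)) = exp r * exp (\<Sum>i\<in>I. (c i / h + a i) * \<xi> i \<omega>)" for \<omega>
    unfolding L_def by (simp only: exp_add[symmetric])
  then have "(\<integral>\<^sup>+\<omega>. ennreal (L \<omega> * exp (\<Sum>i\<in>I. a i * (\<xi> i \<omega> - c i))) \<partial>M)
      = (\<integral>\<^sup>+\<omega>. ennreal (exp r) * ennreal (exp (\<Sum>i\<in>I. (c i / h + a i) * \<xi> i \<omega>)) \<partial>M)"
    by (simp add: ennreal_mult)
  also have "\<dots> = ennreal (exp r) * ennreal (exp ((sqrt h)\<^sup>2 * (\<Sum>i\<in>I. (c i / h + a i)\<^sup>2) / 2))"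
    using rv h by (subst nn_integral_cmult)
      (auto simp: nn_integral_exp_linear_indep_normal[OF ind fin _ dist])
  also have "\<dots> = ennreal (exp (r + h * (\<Sum>i\<in>I. (c i / h + a i)\<^sup>2) / 2))"
    using h by (simp add: ennreal_mult[symmetric] exp_add)
  also have "r + h * (\<Sum>i\<in>I. (c i / h + a i)\<^sup>2) / 2 = h * (\<Sum>i\<in>I. (a i)\<^sup>2) / 2"
    unfolding r_def sum_distrib_left sum_divide_distrib sum_negf[symmetric] sum.distrib[symmetric]
    by (rule sum.cong) (use h in \<open>auto simp: field_simps power2_eq_square\<close>)
  finally show ?thesis .
qed

lemma abs_le_exp_add_exp_minus: "\<bar>u\<bar> \<le> exp u + exp (- u)" for u :: real
  using exp_ge_add_one_self[of u] exp_ge_add_one_self[of "- u"] exp_gt_zero[of u] exp_gt_zero[of "- u"]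
  by linarith

lemma (in prob_space) tilted_abs_moment:
  fixes \<xi> :: "'i \<Rightarrow> 'a \<Rightarrow> real" and c :: "'i \<Rightarrow> real"
  assumes ind: "indep_vars (\<lambda>_. borel) \<xi> I" and fin: "finite I" and h: "0 < h"
    and dist: "\<And>i. i \<in> I \<Longrightarrow> distributed M lborel (\<xi> i) (normal_density 0 (sqrt h))"
    and a: "h * (\<Sum>i\<in>I. (a i)\<^sup>2) \<le> v"
  defines "L \<equiv> \<lambda>\<omega>. exp ((\<Sum>i\<in>I. c i * \<xi> i \<omega>) / h - (\<Sum>i\<in>I. (c i)\<^sup>2) / (2 * h))"
  shows "(\<integral>\<^sup>+\<omega>. ennreal (L \<omega> * \<bar>\<Sum>i\<in>I. a i * (\<xi> i \<omega> - c i)\<bar>) \<partial>M) \<le> ennreal (2 * exp (v / 2))"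
proof -
  define S where "S = (\<lambda>\<omega>. \<Sum>i\<in>I. a i * (\<xi> i \<omega> - c i))"
  have rv: "\<xi> i \<in> borel_measurable M" if "i \<in> I" for i
    using ind that by (auto simp: indep_vars_def)
  have [measurable]: "L \<in> borel_measurable M" "S \<in> borel_measurable M"
    unfolding L_def S_def using rv by measurable
  have L0: "0 \<le> L \<omega>" for \<omega> by (simp add: L_def)
  have m: "- S \<omega> = (\<Sum>i\<in>I. (- a i) * (\<xi> i \<omega> - c i))" for \<omega>
    by (simp add: S_def sum_negf)
  have "(\<integral>\<^sup>+\<omega>. ennreal (L \<omega> * \<bar>S \<omega>\<bar>) \<partial>M) \<le> (\<integral>\<^sup>+\<omega>. ennreal (L \<omega> * exp (S \<omega>)) + ennreal (L \<omega> * exp (- S \<omega>)) \<partial>M)"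
    using L0 abs_le_exp_add_exp_minus
    by (intro nn_integral_mono) (simp add: ennreal_plus[symmetric] distrib_left[symmetric] mult_left_mono del: ennreal_plus)
  also have "\<dots> = (\<integral>\<^sup>+\<omega>. ennreal (L \<omega> * exp (S \<omega>)) \<partial>M) + (\<integral>\<^sup>+\<omega>. ennreal (L \<omega> * exp (- S \<omega>)) \<partial>M)"
    by (rule nn_integral_add) auto
  also have "(\<integral>\<^sup>+\<omega>. ennreal (L \<omega> * exp (S \<omega>)) \<partial>M) = ennreal (exp (h * (\<Sum>i\<in>I. (a i)\<^sup>2) / 2))"
    unfolding S_def L_def by (rule tilted_exp_moment[OF ind fin h dist])
  also have "(\<integral>\<^sup>+\<omega>. ennreal (L \<omega> * exp (- S \<omega>)) \<partial>M) = ennreal (exp (h * (\<Sum>i\<in>I. (- a i)\<^sup>2) / 2))"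
    unfolding m L_def by (rule tilted_exp_moment[OF ind fin h dist])
  also have "ennreal (exp (h * (\<Sum>i\<in>I. (a i)\<^sup>2) / 2)) + ennreal (exp (h * (\<Sum>i\<in>I. (- a i)\<^sup>2) / 2)) \<le> ennreal (2 * exp (v / 2))"
    using a by (simp add: ennreal_plus[symmetric] del: ennreal_plus)
  finally show ?thesis unfolding S_def .
qed

text \<open>Under the weight \<open>L\<close> of \<open>tilted_exp_moment\<close> each \<open>\<bar>S k\<bar>\<close> has mean at most a constant \<open>e\<close>, and so
has \<open>\<bar>Z\<bar>\<close>, where \<open>K Z\<close> is the random part of \<open>ln L\<close>. Markov's inequality under the weight keeps
half of the mass on the event that all of them are small, and there \<open>L \<le> exp (K\<^sup>2/2 + K m)\<close>.
Dividing by this bound on \<open>L\<close> returns to the original measure. The bound does not depend on the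
number \<open>n\<close> of steps.\<close>
lemma (in prob_space) shifted_gaussian_walk_small_deviation:
  fixes \<xi> :: "nat \<Rightarrow> 'a \<Rightarrow> real"
  assumes ind: "indep_vars (\<lambda>_. borel) \<xi> {..<n}" and h: "0 < h" and n: "0 < n" "real n * h \<le> \<tau>"
    and dist: "\<And>i. i < n \<Longrightarrow> distributed M lborel (\<xi> i) (normal_density 0 (sqrt h))"
    and K: "0 < K" "(\<Sum>i<n. (c i)\<^sup>2 / h) \<le> K\<^sup>2"
  defines "m \<equiv> 12 * exp ((\<tau> + 1) / 2)"
    and "S \<equiv> \<lambda>k \<omega>. \<Sum>i<k. \<xi> i \<omega> - c i"
  shows "exp (- K\<^sup>2 / 2 - K * m) / 2 \<le> prob {\<omega> \<in> space M. (\<Sum>k<n. \<bar>S k \<omega>\<bar>) / real n + \<bar>S n \<omega>\<bar> \<le> m}"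
proof -
  have rv: "\<xi> i \<in> borel_measurable M" if "i < n" for i
    using ind that by (auto simp: indep_vars_def)
  have \<tau>: "0 < \<tau>" using n h by (smt (verit) mult_pos_pos of_nat_0_less_iff)
  define L where "L = (\<lambda>\<omega>. exp ((\<Sum>i<n. c i * \<xi> i \<omega>) / h - (\<Sum>i<n. (c i)\<^sup>2) / (2 * h)))"
  define Z where "Z = (\<lambda>\<omega>. \<Sum>i<n. (c i / (h * K)) * (\<xi> i \<omega> - c i))"
  \<comment> \<open>\<open>R\<close> has weighted mean at most \<open>3 * e\<close>, which is half of \<open>m = 6 * e\<close>.\<close>
  define R where "R = (\<lambda>\<omega>. (\<Sum>k<n. \<bar>S k \<omega>\<bar>) / real n + \<bar>S n \<omega>\<bar> + \<bar>Z \<omega>\<bar>)"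
  define E where "E = {\<omega> \<in> space M. (\<Sum>k<n. \<bar>S k \<omega>\<bar>) / real n + \<bar>S n \<omega>\<bar> \<le> m}"
  define B where "B = exp (K\<^sup>2 / 2 + K * m)"
  define e where "e = 2 * exp ((\<tau> + 1) / 2)"
  have m: "m = 6 * e" "0 < m" "0 < e" by (simp_all add: m_def e_def)
  have Sm[measurable]: "S k \<in> borel_measurable M" if "k \<le> n" for k
    unfolding S_def by (intro borel_measurable_sum borel_measurable_diff rv borel_measurable_const) (use that in auto)
  have [measurable]: "L \<in> borel_measurable M" "Z \<in> borel_measurable M"
    unfolding L_def Z_def using rv by measurable
  have [measurable]: "(\<lambda>\<omega>. \<Sum>k<n. \<bar>S k \<omega>\<bar>) \<in> borel_measurable M"
    using Sm by (intro borel_measurable_sum borel_measurable_abs) auto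
  have [measurable]: "R \<in> borel_measurable M" "E \<in> sets M"
    unfolding R_def E_def using Sm[of n] by measurable
  have L0: "0 \<le> L \<omega>" for \<omega> by (simp add: L_def)
  have S_bound: "(\<integral>\<^sup>+\<omega>. ennreal (L \<omega> * \<bar>S k \<omega>\<bar>) \<partial>M) \<le> ennreal e" if k: "k \<le> n" for k
  proof -
    define a :: "nat \<Rightarrow> real" where "a = (\<lambda>i. if i < k then 1 else 0)"
    have r: "{i. i < n \<and> i < k} = {..<k}" using k by auto
    have "S k \<omega> = (\<Sum>i<n. a i * (\<xi> i \<omega> - c i))" for \<omega>
      using k by (simp add: S_def a_def if_distrib[of "\<lambda>x. x * _"] sum.If_cases Int_def r cong: if_cong)
    moreover have "h * (\<Sum>i<n. (a i)\<^sup>2) \<le> \<tau>"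
    proof -
      have "(\<Sum>i<n. (a i)\<^sup>2) \<le> (\<Sum>i<n. 1)" by (intro sum_mono) (auto simp: a_def)
      then have "h * (\<Sum>i<n. (a i)\<^sup>2) \<le> h * real n" using h by simp
      then show ?thesis using n by (simp add: mult.commute)
    qed
    ultimately have "(\<integral>\<^sup>+\<omega>. ennreal (L \<omega> * \<bar>S k \<omega>\<bar>) \<partial>M) \<le> ennreal (2 * exp (\<tau> / 2))"
      unfolding L_def using tilted_abs_moment[OF ind _ h dist, where a = a and v = \<tau> and c = c] by simp
    also have "\<dots> \<le> ennreal e" by (intro ennreal_leI) (simp add: e_def)
    finally show ?thesis .
  qed
  have Z_bound: "(\<integral>\<^sup>+\<omega>. ennreal (L \<omega> * \<bar>Z \<omega>\<bar>) \<partial>M) \<le> ennreal e"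
  proof -
    have "h * (\<Sum>i<n. (c i / (h * K))\<^sup>2) = (\<Sum>i<n. (c i)\<^sup>2 / h) / K\<^sup>2"
      unfolding sum_distrib_left sum_divide_distrib
      by (rule sum.cong) (use h K in \<open>auto simp: field_simps power2_eq_square\<close>)
    also have "\<dots> \<le> 1" using K by simp
    finally have "(\<integral>\<^sup>+\<omega>. ennreal (L \<omega> * \<bar>Z \<omega>\<bar>) \<partial>M) \<le> ennreal (2 * exp (1 / 2))"
      unfolding L_def Z_def using tilted_abs_moment[OF ind _ h dist, where a = "\<lambda>i. c i / (h * K)" and v = 1 and c = c] by simp
    also have "\<dots> \<le> ennreal e" using \<tau> by (intro ennreal_leI) (simp add: e_def)
    finally show ?thesis .
  qed
  have R_bound: "(\<integral>\<^sup>+\<omega>. ennreal (L \<omega> * R \<omega>) \<partial>M) \<le> ennreal (3 * e)"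
  proof -
    have "ennreal (L \<omega> * R \<omega>) = (\<Sum>k<n. ennreal (1 / real n) * ennreal (L \<omega> * \<bar>S k \<omega>\<bar>))
        + (ennreal (L \<omega> * \<bar>S n \<omega>\<bar>) + ennreal (L \<omega> * \<bar>Z \<omega>\<bar>))" for \<omega>
    proof -
      have "(\<Sum>k<n. ennreal (1 / real n) * ennreal (L \<omega> * \<bar>S k \<omega>\<bar>)) = ennreal (\<Sum>k<n. 1 / real n * (L \<omega> * \<bar>S k \<omega>\<bar>))"
        using L0 by (simp add: ennreal_mult[symmetric] sum_ennreal)
      also have "(\<Sum>k<n. 1 / real n * (L \<omega> * \<bar>S k \<omega>\<bar>)) = L \<omega> * ((\<Sum>k<n. \<bar>S k \<omega>\<bar>) / real n)"
        by (simp add: sum_distrib_left sum_divide_distrib)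
      finally show ?thesis
        using L0 by (simp add: R_def distrib_left ennreal_plus[symmetric] sum_nonneg add.assoc del: ennreal_plus)
    qed
    then have "(\<integral>\<^sup>+\<omega>. ennreal (L \<omega> * R \<omega>) \<partial>M)
        = (\<integral>\<^sup>+\<omega>. (\<Sum>k<n. ennreal (1 / real n) * ennreal (L \<omega> * \<bar>S k \<omega>\<bar>))
          + (ennreal (L \<omega> * \<bar>S n \<omega>\<bar>) + ennreal (L \<omega> * \<bar>Z \<omega>\<bar>)) \<partial>M)" by simp
    also have "\<dots> = (\<Sum>k<n. ennreal (1 / real n) * (\<integral>\<^sup>+\<omega>. ennreal (L \<omega> * \<bar>S k \<omega>\<bar>) \<partial>M))
        + ((\<integral>\<^sup>+\<omega>. ennreal (L \<omega> * \<bar>S n \<omega>\<bar>) \<partial>M) + (\<integral>\<^sup>+\<omega>. ennreal (L \<omega> * \<bar>Z \<omega>\<bar>) \<partial>M))"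
    proof -
      have 1: "(\<integral>\<^sup>+\<omega>. (\<Sum>k<n. ennreal (1 / real n) * ennreal (L \<omega> * \<bar>S k \<omega>\<bar>)) \<partial>M)
          = (\<Sum>k<n. \<integral>\<^sup>+\<omega>. ennreal (1 / real n) * ennreal (L \<omega> * \<bar>S k \<omega>\<bar>) \<partial>M)"
        by (rule nn_integral_sum) (use Sm in auto)
      have 2: "(\<integral>\<^sup>+\<omega>. ennreal (1 / real n) * ennreal (L \<omega> * \<bar>S k \<omega>\<bar>) \<partial>M)
          = ennreal (1 / real n) * (\<integral>\<^sup>+\<omega>. ennreal (L \<omega> * \<bar>S k \<omega>\<bar>) \<partial>M)" if "k < n" for k
        by (rule nn_integral_cmult) (use Sm that in auto)
      have 3: "(\<lambda>\<omega>. \<Sum>k<n. ennreal (1 / real n) * ennreal (L \<omega> * \<bar>S k \<omega>\<bar>)) \<in> borel_measurable M"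
        by (intro borel_measurable_sum) (use Sm in auto)
      show ?thesis
        using Sm[of n] 3 by (simp add: nn_integral_add 1 2)
    qed
    also have "\<dots> \<le> (\<Sum>k<n. ennreal (1 / real n) * ennreal e) + (ennreal e + ennreal e)"
      by (intro add_mono sum_mono mult_left_mono S_bound Z_bound) auto
    also have "(\<Sum>k<n. ennreal (1 / real n) * ennreal e) = (\<Sum>k<n. ennreal (1 / real n * e))"
      using m by (subst ennreal_mult) auto
    also have "\<dots> = ennreal (\<Sum>k<n. 1 / real n * e)"
      using m by (intro sum_ennreal) auto
    also have "(\<Sum>k<n. 1 / real n * e) = e" using n by simp
    also have "ennreal e + (ennreal e + ennreal e) = ennreal (3 * e)"
      using m by (simp add: ennreal_plus[symmetric] del: ennreal_plus)
    finally show ?thesis .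
  qed
  have total: "(\<integral>\<^sup>+\<omega>. ennreal (L \<omega>) \<partial>M) = 1"
    using tilted_exp_moment[OF ind _ h dist, where a = "\<lambda>_. 0" and c = c] by (simp add: L_def)
  \<comment> \<open>Markov's inequality and the bound on \<open>L\<close> in one estimate: the second term pays for \<open>R > m\<close>.\<close>
  have pointwise: "ennreal (L \<omega>) \<le> ennreal B * indicator E \<omega> + ennreal (1 / m) * ennreal (L \<omega> * R \<omega>)"
    if \<omega>: "\<omega> \<in> space M" for \<omega>
  proof (cases "R \<omega> \<le> m")
    case True
    have nn: "0 \<le> (\<Sum>k<n. \<bar>S k \<omega>\<bar>) / real n + \<bar>S n \<omega>\<bar>" by (intro add_nonneg_nonneg divide_nonneg_nonneg sum_nonneg) auto
    have "\<omega> \<in> E" using True \<omega> by (simp add: R_def E_def)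
    moreover have "L \<omega> \<le> B"
    proof -
      have "(\<Sum>i<n. c i * \<xi> i \<omega>) / h - (\<Sum>i<n. (c i)\<^sup>2) / (2 * h) = K * Z \<omega> + (\<Sum>i<n. (c i)\<^sup>2 / h) / 2"
        unfolding Z_def sum_divide_distrib sum_distrib_left sum_subtractf[symmetric] sum.distrib[symmetric]
        by (rule sum.cong) (use h K in \<open>auto simp: field_simps power2_eq_square\<close>)
      also have "\<dots> \<le> K * m + K\<^sup>2 / 2"
      proof (intro add_mono mult_left_mono)
        show "Z \<omega> \<le> m" using True nn unfolding R_def by linarith
      qed (use K in auto)
      finally show ?thesis by (simp add: L_def B_def add.commute)
    qed
    ultimately show ?thesis by (simp add: add_increasing2 ennreal_leI)
  next
    case False
    then have "L \<omega> * m \<le> L \<omega> * R \<omega>" using L0 by (intro mult_left_mono) auto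
    then have "L \<omega> \<le> 1 / m * (L \<omega> * R \<omega>)" using m by (simp add: field_simps)
    then have "ennreal (L \<omega>) \<le> ennreal (1 / m) * ennreal (L \<omega> * R \<omega>)"
      using L0 m False by (subst ennreal_mult[symmetric]) (auto intro!: ennreal_leI)
    then show ?thesis by (rule add_increasing[OF zero_le])
  qed
  have "1 \<le> (\<integral>\<^sup>+\<omega>. ennreal B * indicator E \<omega> + ennreal (1 / m) * ennreal (L \<omega> * R \<omega>) \<partial>M)"
    unfolding total[symmetric] by (rule nn_integral_mono) (rule pointwise)
  also have "\<dots> = ennreal B * emeasure M E + ennreal (1 / m) * (\<integral>\<^sup>+\<omega>. ennreal (L \<omega> * R \<omega>) \<partial>M)"
    by (simp add: nn_integral_add nn_integral_cmult)
  also have "\<dots> \<le> ennreal B * emeasure M E + ennreal (1 / m) * ennreal (3 * e)"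
    by (intro add_mono mult_left_mono R_bound) auto
  also have "\<dots> = ennreal (B * prob E + 1 / 2)"
  proof -
    have "ennreal (1 / m) * ennreal (3 * e) = ennreal (1 / 2)"
      using m by (subst ennreal_mult[symmetric]) auto
    moreover have "ennreal B * emeasure M E = ennreal (B * prob E)"
      by (simp add: emeasure_eq_measure ennreal_mult B_def)
    ultimately show ?thesis by (simp add: ennreal_plus[symmetric] B_def del: ennreal_plus ennreal_half)
  qed
  finally have "1 / 2 \<le> B * prob E" by simp
  then have "exp (- K\<^sup>2 / 2 - K * m) * (1 / 2) \<le> exp (- K\<^sup>2 / 2 - K * m) * (B * prob E)"
    by (intro mult_left_mono) auto
  also have "\<dots> = exp (- K\<^sup>2 / 2 - K * m + (K\<^sup>2 / 2 + K * m)) * prob E" unfolding B_def exp_add by simp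
  also have "\<dots> = prob E" by simp
  finally show ?thesis by (simp add: E_def)
qed

text \<open>Fatou's lemma for sets: a uniform lower bound on the probabilities of the grid events passes to
any event that contains their upper limit.\<close>
lemma (in prob_space) prob_ge_of_infinitely_often:
  fixes E :: "nat \<Rightarrow> 'a set"
  assumes E: "\<And>n. E n \<in> events" "\<And>n. 0 < n \<Longrightarrow> p \<le> prob (E n)" and G: "G \<in> events"
    and sub: "AE \<omega> in M. (\<exists>\<^sub>\<infinity>n. \<omega> \<in> E n) \<longrightarrow> \<omega> \<in> G"
  shows "p \<le> prob G"
proof -
  define U where "U = (\<lambda>k. \<Union>n\<in>{k..}. E n)"
  have Um: "range U \<subseteq> events" using E(1) by (auto simp: U_def)
  have "decseq U" unfolding U_def decseq_def by fastforce
  with Um have "(\<lambda>k. prob (U k)) \<longlonglongrightarrow> prob (\<Inter>k. U k)" by (rule finite_Lim_measure_decseq)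
  moreover have "p \<le> prob (U k)" for k
  proof -
    have "p \<le> prob (E (Suc k))" by (rule E) simp
    also have "\<dots> \<le> prob (U k)"
      using Um by (intro finite_measure_mono) (auto simp: U_def intro!: bexI[of _ "Suc k"])
    finally show ?thesis .
  qed
  ultimately have "p \<le> prob (\<Inter>k. U k)" by (intro LIMSEQ_le_const) auto
  also have "\<dots> \<le> prob G"
  proof (rule finite_measure_mono_AE[OF _ G])
    show "AE \<omega> in M. \<omega> \<in> (\<Inter>k. U k) \<longrightarrow> \<omega> \<in> G"
      using sub by eventually_elim (auto simp: U_def INFM_nat_le)
  qed
  finally show ?thesis .
qed

section \<open>Gaussian bridges\<close>
text \<open>For independent increments \<open>u\<close> and \<open>v\<close> over consecutive times \<open>r h\<close> and \<open>(1 - r) h\<close>, the total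
increment \<open>u + v\<close> and the bridge value \<open>(1 - r) u - r v\<close> are independent. The linear map between
the two pairs has determinant of absolute value one, so this identity of densities has no Jacobian.\<close>
lemma normal_density_bridge_factorisation:
  assumes r: "0 < r" "r < 1" and h: "0 < h"
  shows "normal_density 0 (sqrt (r * h)) u * normal_density 0 (sqrt ((1 - r) * h)) v
    = normal_density 0 (sqrt h) (u + v) * normal_density 0 (sqrt (r * (1 - r) * h)) ((1 - r) * u - r * v)"
proof -
  have "- u\<^sup>2 / (2 * (r * h)) + - v\<^sup>2 / (2 * ((1 - r) * h))
      = - (u + v)\<^sup>2 / (2 * h) + - ((1 - r) * u - r * v)\<^sup>2 / (2 * (r * (1 - r) * h))"
    using r h by (simp add: divide_simps) (simp add: power2_eq_square algebra_simps)
  then have e: "exp (- u\<^sup>2 / (2 * (r * h))) * exp (- v\<^sup>2 / (2 * ((1 - r) * h)))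
      = exp (- (u + v)\<^sup>2 / (2 * h)) * exp (- ((1 - r) * u - r * v)\<^sup>2 / (2 * (r * (1 - r) * h)))"
    by (simp only: exp_add[symmetric])
  have p: "1 / sqrt (2 * pi * (r * h)) * (1 / sqrt (2 * pi * ((1 - r) * h)))
      = 1 / sqrt (2 * pi * h) * (1 / sqrt (2 * pi * (r * (1 - r) * h)))"
    by (simp add: real_sqrt_mult[symmetric] mult_ac)
  have q: "(sqrt (r * h))\<^sup>2 = r * h" "(sqrt ((1 - r) * h))\<^sup>2 = (1 - r) * h" "(sqrt h)\<^sup>2 = h"
    "(sqrt (r * (1 - r) * h))\<^sup>2 = r * (1 - r) * h"
    using r h by auto
  have "normal_density 0 (sqrt (r * h)) u * normal_density 0 (sqrt ((1 - r) * h)) v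
     = (1 / sqrt (2 * pi * (r * h)) * (1 / sqrt (2 * pi * ((1 - r) * h)))) *
       (exp (- u\<^sup>2 / (2 * (r * h))) * exp (- v\<^sup>2 / (2 * ((1 - r) * h))))"
    unfolding normal_density_def q by simp
  also have "\<dots> = normal_density 0 (sqrt h) (u + v) * normal_density 0 (sqrt (r * (1 - r) * h)) ((1 - r) * u - r * v)"
    unfolding e p normal_density_def q by simp
  finally show ?thesis .
qed

lemma nn_integral_bridge_factorisation:
  assumes r: "0 < r" "r < 1" and h: "0 < h"
    and [measurable]: "F \<in> borel_measurable borel" "G \<in> borel_measurable borel"
  shows "(\<integral>\<^sup>+u. \<integral>\<^sup>+v. ennreal (normal_density 0 (sqrt (r * h)) u * normal_density 0 (sqrt ((1 - r) * h)) v) *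
      (F (u + v) * G ((1 - r) * u - r * v)) \<partial>lborel \<partial>lborel)
    = (\<integral>\<^sup>+s. ennreal (normal_density 0 (sqrt h) s) * F s \<partial>lborel) *
      (\<integral>\<^sup>+w. ennreal (normal_density 0 (sqrt (r * (1 - r) * h)) w) * G w \<partial>lborel)"
proof -
  define f where "f = (\<lambda>s. ennreal (normal_density 0 (sqrt h) s) * F s)"
  define g where "g = (\<lambda>w. ennreal (normal_density 0 (sqrt (r * (1 - r) * h)) w) * G w)"
  have [measurable]: "f \<in> borel_measurable borel" "g \<in> borel_measurable borel"
    unfolding f_def g_def by measurable
  have "(\<integral>\<^sup>+u. \<integral>\<^sup>+v. ennreal (normal_density 0 (sqrt (r * h)) u * normal_density 0 (sqrt ((1 - r) * h)) v) *
      (F (u + v) * G ((1 - r) * u - r * v)) \<partial>lborel \<partial>lborel)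
    = (\<integral>\<^sup>+u. \<integral>\<^sup>+v. f (u + v) * g (u - r * (u + v)) \<partial>lborel \<partial>lborel)"
    unfolding normal_density_bridge_factorisation[OF r h] f_def g_def
    by (simp add: ennreal_mult algebra_simps)
  also have "\<dots> = (\<integral>\<^sup>+u. \<integral>\<^sup>+s. f s * g (u - r * s) \<partial>lborel \<partial>lborel)"
    by (rule nn_integral_cong, subst nn_integral_real_affine[where c = 1 and t = "u" for u]) auto
  also have "\<dots> = (\<integral>\<^sup>+s. \<integral>\<^sup>+u. f s * g (u - r * s) \<partial>lborel \<partial>lborel)"
    by (rule lborel_pair.Fubini') measurable
  also have "\<dots> = (\<integral>\<^sup>+s. f s * (\<integral>\<^sup>+w. g w \<partial>lborel) \<partial>lborel)"
  proof (rule nn_integral_cong)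
    fix s
    have "(\<integral>\<^sup>+w. g w \<partial>lborel) = (\<integral>\<^sup>+u. g (u - r * s) \<partial>lborel)"
      by (subst nn_integral_real_affine[where c = 1 and t = "- (r * s)"]) auto
    then show "(\<integral>\<^sup>+u. f s * g (u - r * s) \<partial>lborel) = f s * (\<integral>\<^sup>+w. g w \<partial>lborel)"
      by (simp add: nn_integral_cmult)
  qed
  also have "\<dots> = (\<integral>\<^sup>+s. f s \<partial>lborel) * (\<integral>\<^sup>+w. g w \<partial>lborel)"
    by (rule nn_integral_multc) measurable
  finally show ?thesis unfolding f_def g_def .
qed

text \<open>The factor of one block. The first quadratic term leaves a Gaussian integral of inverse variance
\<open>\<epsilon> / h\<close>, which costs \<open>1 / sqrt \<epsilon>\<close>. The bridge has variance \<open>r (1 - r) h \<le> h / 4\<close>, so the condition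
\<open>\<mu> h \<le> 2\<close> removes at most half of its inverse variance and costs at most \<open>sqrt 2\<close>.\<close>
lemma (in prob_space) bridge_exp_quadratic_moment:
  assumes r: "0 < r" "r < 1" and h: "0 < h" and \<epsilon>: "0 < \<epsilon>" and \<mu>: "\<mu> * h \<le> 2"
    and ind: "indep_var borel X borel Y"
    and X: "distributed M lborel X (normal_density 0 (sqrt (r * h)))"
    and Y: "distributed M lborel Y (normal_density 0 (sqrt ((1 - r) * h)))"
  shows "(\<integral>\<^sup>+\<omega>. ennreal (exp ((1 - \<epsilon>) * (X \<omega> + Y \<omega>)\<^sup>2 / (2 * h) + \<mu> * ((1 - r) * X \<omega> - r * Y \<omega>)\<^sup>2 / 2)) \<partial>M)
    \<le> ennreal (sqrt (2 / \<epsilon>))"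
proof -
  define l where "l = 1 - \<mu> * h * (r * (1 - r))"
  have "r * (1 - r) \<le> 1 / 4" using zero_le_power2[of "2 * r - 1"] by (simp add: power2_eq_square algebra_simps)
  moreover have "0 \<le> r * (1 - r)" using r by simp
  ultimately have "\<mu> * h * (r * (1 - r)) \<le> 2 * (1 / 4)"
    using \<mu> by (intro order_trans[OF mult_right_mono[OF \<mu>]]) auto
  then have l: "1 / 2 \<le> l" by (simp add: l_def)
  define F where "F = (\<lambda>s. ennreal (exp ((1 - \<epsilon>) * s\<^sup>2 / (2 * h))))"
  define G where "G = (\<lambda>w. ennreal (exp (\<mu> * w\<^sup>2 / 2)))"
  have [measurable]: "F \<in> borel_measurable borel" "G \<in> borel_measurable borel"
    unfolding F_def G_def by measurable
  have sf: "sigma_finite_measure lborel" by (rule sigma_finite_lborel)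
  have "distributed M (lborel \<Otimes>\<^sub>M lborel) (\<lambda>\<omega>. (X \<omega>, Y \<omega>))
     (\<lambda>(u, v). ennreal (normal_density 0 (sqrt (r * h)) u) * ennreal (normal_density 0 (sqrt ((1 - r) * h)) v))"
  proof (rule distributed_joint_indep[OF sf sf X Y])
    show "indep_var lborel X lborel Y"
      using ind unfolding indep_var_eq by simp
  qed
  note joint = distributed_nn_integral[OF this, of "\<lambda>(u, v). F (u + v) * G ((1 - r) * u - r * v)"]
  have "(\<integral>\<^sup>+\<omega>. ennreal (exp ((1 - \<epsilon>) * (X \<omega> + Y \<omega>)\<^sup>2 / (2 * h) + \<mu> * ((1 - r) * X \<omega> - r * Y \<omega>)\<^sup>2 / 2)) \<partial>M)
      = (\<integral>\<^sup>+\<omega>. F (X \<omega> + Y \<omega>) * G ((1 - r) * X \<omega> - r * Y \<omega>) \<partial>M)"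
    by (simp add: F_def G_def ennreal_mult[symmetric] exp_add)
  also have "\<dots> = (\<integral>\<^sup>+p. (case p of (u, v) \<Rightarrow> ennreal (normal_density 0 (sqrt (r * h)) u) * ennreal (normal_density 0 (sqrt ((1 - r) * h)) v)) *
     (case p of (u, v) \<Rightarrow> F (u + v) * G ((1 - r) * u - r * v)) \<partial>(lborel \<Otimes>\<^sub>M lborel))"
    by (subst joint) simp_all
  also have "\<dots> = (\<integral>\<^sup>+u. \<integral>\<^sup>+v. ennreal (normal_density 0 (sqrt (r * h)) u * normal_density 0 (sqrt ((1 - r) * h)) v) *
      (F (u + v) * G ((1 - r) * u - r * v)) \<partial>lborel \<partial>lborel)"
    by (subst lborel.nn_integral_fst[symmetric]) (simp_all add: ennreal_mult)
  also have "\<dots> = (\<integral>\<^sup>+s. ennreal (normal_density 0 (sqrt h) s) * F s \<partial>lborel) *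
      (\<integral>\<^sup>+w. ennreal (normal_density 0 (sqrt (r * (1 - r) * h)) w) * G w \<partial>lborel)"
    by (rule nn_integral_bridge_factorisation[OF r h]) measurable
  also have "(\<integral>\<^sup>+s. ennreal (normal_density 0 (sqrt h) s) * F s \<partial>lborel) = ennreal (1 / sqrt \<epsilon>)"
    using nn_integral_exp_quadratic_normal[of "sqrt h" \<epsilon>] h \<epsilon> by (simp add: F_def)
  also have "(\<integral>\<^sup>+w. ennreal (normal_density 0 (sqrt (r * (1 - r) * h)) w) * G w \<partial>lborel) = ennreal (1 / sqrt l)"
  proof -
    have s: "0 < r * (1 - r) * h" using r h by simp
    have "(1 - l) * w\<^sup>2 / (2 * (sqrt (r * (1 - r) * h))\<^sup>2) = \<mu> * w\<^sup>2 / 2" for w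
      using s r h by (simp add: l_def field_simps)
    with nn_integral_exp_quadratic_normal[of "sqrt (r * (1 - r) * h)" l] s l show ?thesis
      unfolding G_def by (simp del: real_sqrt_pow2 real_sqrt_pow2_iff)
  qed
  also have "ennreal (1 / sqrt \<epsilon>) * ennreal (1 / sqrt l) \<le> ennreal (sqrt (2 / \<epsilon>))"
  proof -
    have "1 / sqrt l \<le> sqrt 2"
      using l real_sqrt_le_mono[of "1 / l" 2] by (simp add: real_sqrt_divide field_simps)
    then have "1 / sqrt \<epsilon> * (1 / sqrt l) \<le> 1 / sqrt \<epsilon> * sqrt 2"
      using \<epsilon> by (intro mult_left_mono) auto
    then show ?thesis
      using \<epsilon> l by (subst ennreal_mult[symmetric]) (auto intro!: ennreal_leI simp: real_sqrt_divide)
  qed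
  finally show ?thesis .
qed

lemma (in prob_space) indep_pair_bridge_exp_quadratic_moment:
  fixes X :: "nat \<Rightarrow> 'a \<Rightarrow> real"
  assumes ind: "indep_vars (\<lambda>_. borel) X {..<2 * N}"
    and r: "0 < r" "r < 1" and h: "0 < h" and \<epsilon>: "0 < \<epsilon>" and \<mu>: "\<mu> * h \<le> 2"
    and even: "\<And>i. i < N \<Longrightarrow> distributed M lborel (X (2 * i)) (normal_density 0 (sqrt (r * h)))"
    and odd: "\<And>i. i < N \<Longrightarrow> distributed M lborel (X (2 * i + 1)) (normal_density 0 (sqrt ((1 - r) * h)))"
  shows "(\<integral>\<^sup>+\<omega>. ennreal (exp (\<Sum>i<N. (1 - \<epsilon>) * (X (2 * i) \<omega> + X (2 * i + 1) \<omega>)\<^sup>2 / (2 * h)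
      + \<mu> * ((1 - r) * X (2 * i) \<omega> - r * X (2 * i + 1) \<omega>)\<^sup>2 / 2)) \<partial>M) \<le> ennreal (sqrt (2 / \<epsilon>) ^ N)"
proof -
  define K where "K = (\<lambda>i. {2 * i, 2 * i + 1 :: nat})"
  define g where "g = (\<lambda>i (f :: nat \<Rightarrow> real). ennreal (exp ((1 - \<epsilon>) * (f (2 * i) + f (2 * i + 1))\<^sup>2 / (2 * h)
      + \<mu> * ((1 - r) * f (2 * i) - r * f (2 * i + 1))\<^sup>2 / 2)))"
  have "indep_vars (\<lambda>i. PiM (K i) (\<lambda>_. borel)) (\<lambda>i \<omega>. restrict (\<lambda>j. X j \<omega>) (K i)) {..<N}"
  proof (rule indep_vars_restrict[OF ind])
    show "disjoint_family_on K {..<N}" unfolding disjoint_family_on_def K_def by auto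
  qed (auto simp: K_def)
  then have "indep_vars (\<lambda>_. borel) (\<lambda>i \<omega>. g i (restrict (\<lambda>j. X j \<omega>) (K i))) {..<N}"
  proof (rule indep_vars_compose2)
    show "g i \<in> borel_measurable (PiM (K i) (\<lambda>_. borel))" for i
      unfolding g_def K_def by measurable
  qed
  then have ind': "indep_vars (\<lambda>_. borel) (\<lambda>i \<omega>. g i (\<lambda>j. X j \<omega>)) {..<N}"
    by (simp add: g_def K_def)
  have "(\<integral>\<^sup>+\<omega>. ennreal (exp (\<Sum>i<N. (1 - \<epsilon>) * (X (2 * i) \<omega> + X (2 * i + 1) \<omega>)\<^sup>2 / (2 * h)
      + \<mu> * ((1 - r) * X (2 * i) \<omega> - r * X (2 * i + 1) \<omega>)\<^sup>2 / 2)) \<partial>M)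
      = (\<integral>\<^sup>+\<omega>. (\<Prod>i<N. g i (\<lambda>j. X j \<omega>)) \<partial>M)"
    by (simp add: g_def exp_sum prod_ennreal)
  also have "\<dots> = (\<Prod>i<N. \<integral>\<^sup>+\<omega>. g i (\<lambda>j. X j \<omega>) \<partial>M)"
    by (rule indep_vars_nn_integral[OF _ ind']) auto
  also have "\<dots> \<le> (\<Prod>i<N. ennreal (sqrt (2 / \<epsilon>)))"
  proof (rule prod_mono_ennreal)
    fix i assume i: "i \<in> {..<N}"
    have "indep_var (PiM {2 * i} (\<lambda>_. borel)) (\<lambda>\<omega>. restrict (\<lambda>j. X j \<omega>) {2 * i})
       (PiM {2 * i + 1} (\<lambda>_. borel)) (\<lambda>\<omega>. restrict (\<lambda>j. X j \<omega>) {2 * i + 1})"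
      by (rule indep_var_restrict[OF ind]) (use i in auto)
    then have "indep_var borel ((\<lambda>f. f (2 * i)) \<circ> (\<lambda>\<omega>. restrict (\<lambda>j. X j \<omega>) {2 * i}))
        borel ((\<lambda>f. f (2 * i + 1)) \<circ> (\<lambda>\<omega>. restrict (\<lambda>j. X j \<omega>) {2 * i + 1}))"
      by (rule indep_var_compose) (auto intro!: measurable_component_singleton)
    then have "indep_var borel (X (2 * i)) borel (X (2 * i + 1))"
      by (simp add: o_def)
    from bridge_exp_quadratic_moment[OF r h \<epsilon> \<mu> this even odd] i
    show "(\<integral>\<^sup>+\<omega>. g i (\<lambda>j. X j \<omega>) \<partial>M) \<le> ennreal (sqrt (2 / \<epsilon>))"
      by (simp add: g_def)
  qed
  also have "\<dots> = ennreal (sqrt (2 / \<epsilon>) ^ N)" using \<epsilon> by (simp add: ennreal_power)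
  finally show ?thesis .
qed

section \<open>Interpolated noise as a control\<close>
definition clamp01 :: "real \<Rightarrow> real" where "clamp01 u = max 0 (min 1 u)"

text \<open>A sum of ramps rather than a case distinction over cells, so that continuity and the
integral of the velocity can be read off termwise.\<close>
definition linear_interpolation :: "(real \<Rightarrow> real) \<Rightarrow> real \<Rightarrow> real \<Rightarrow> nat \<Rightarrow> real \<Rightarrow> real" where
  "linear_interpolation w t h N s =
    w t + (\<Sum>i<N. (w (t + real (Suc i) * h) - w (t + real i * h)) * clamp01 ((s - (t + real i * h)) / h))"

definition interpolation_velocity :: "(real \<Rightarrow> real) \<Rightarrow> real \<Rightarrow> real \<Rightarrow> nat \<Rightarrow> real \<Rightarrow> real" where
  "interpolation_velocity w t h N s =
    (\<Sum>i<N. (w (t + real (Suc i) * h) - w (t + real i * h)) / h * indicator {t + real i * h..<t + real (Suc i) * h} s)"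

lemma continuous_on_linear_interpolation: "0 < h \<Longrightarrow> continuous_on S (linear_interpolation w t h N)"
  unfolding linear_interpolation_def[abs_def] clamp01_def by (intro continuous_intros) auto

lemma linear_interpolation_cell:
  assumes h: "0 < h" and j: "j < N" and r: "0 \<le> r" "r \<le> 1"
  shows "linear_interpolation w t h N (t + real j * h + r * h)
    = (1 - r) * w (t + real j * h) + r * w (t + real (Suc j) * h)"
proof -
  define p where "p = (\<lambda>i. w (t + real i * h))"
  have c: "clamp01 ((t + real j * h + r * h - (t + real i * h)) / h) = (if i < j then 1 else if i = j then r else 0)" for i
  proof -
    have e: "(t + real j * h + r * h - (t + real i * h)) / h = real j - real i + r"
      using h by (simp add: field_simps)
    show ?thesis
    proof (cases i j rule: linorder_cases)
      case less
      then have "1 \<le> real j - real i" by linarith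
      then show ?thesis unfolding e using r less by (simp add: clamp01_def)
    next
      case equal then show ?thesis unfolding e using r by (simp add: clamp01_def)
    next
      case greater
      then have "real j - real i \<le> -1" by linarith
      then show ?thesis unfolding e using r greater by (simp add: clamp01_def)
    qed
  qed
  have "linear_interpolation w t h N (t + real j * h + r * h)
      = p 0 + (\<Sum>i<N. (p (Suc i) - p i) * (if i < j then 1 else if i = j then r else 0))"
    unfolding linear_interpolation_def c by (simp add: p_def)
  also have "(\<Sum>i<N. (p (Suc i) - p i) * (if i < j then 1 else if i = j then r else 0))
      = (\<Sum>i\<in>{..<Suc j}. (p (Suc i) - p i) * (if i < j then 1 else if i = j then r else 0))"
    by (rule sum.mono_neutral_right) (use j in auto)
  also have "\<dots> = (\<Sum>i<j. p (Suc i) - p i) + (p (Suc j) - p j) * r" by simp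
  also have "(\<Sum>i<j. p (Suc i) - p i) = p j - p 0" by (rule sum_lessThan_telescope)
  finally show ?thesis by (simp add: p_def algebra_simps)
qed

lemma grid_le:
  assumes "0 < h" "real N * h = T - t" "i \<le> N"
  shows "t + real i * h \<le> T"
proof -
  have "real i * h \<le> real N * h" using assms by (intro mult_right_mono) auto
  then show ?thesis using assms by simp
qed

lemma set_integral_step:
  assumes h: "0 < h" and s: "t \<le> s"
  shows "set_integrable lborel {t..s} (\<lambda>r. c * indicator {t + real i * h..<t + real (Suc i) * h} r)"
    "(LINT r:{t..s}|lborel. c * indicator {t + real i * h..<t + real (Suc i) * h} r) = c * (h * clamp01 ((s - (t + real i * h)) / h))"
proof -
  define a where "a = t + real i * h"
  have a: "t \<le> a" "t + real (Suc i) * h = a + h" using h by (auto simp: a_def algebra_simps)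
  define D where "D = {t..s} \<inter> {a..<a + h}"
  have ind: "indicator {t..s} r *\<^sub>R (c * indicator {a..<a + h} r) = c * indicator D r" for r :: real
    by (auto simp: D_def indicator_def)
  have fin: "emeasure lborel D < \<infinity>"
    by (rule le_less_trans[OF emeasure_mono[of D "{t..s}"]]) (use s in \<open>auto simp: D_def emeasure_lborel_Icc_eq\<close>)
  have Dm: "D \<in> sets lborel" by (simp add: D_def)
  have meas: "measure lborel D = h * clamp01 ((s - a) / h)"
  proof (cases "s < a")
    case True
    then have "D = {}" by (auto simp: D_def)
    moreover have "(s - a) / h \<le> 0" using True h by (simp add: divide_nonpos_pos)
    ultimately show ?thesis by (simp add: clamp01_def)
  next
    case False
    show ?thesis
    proof (cases "s < a + h")
      case True
      then have "D = {a..s}" using a by (auto simp: D_def)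
      moreover have "0 \<le> (s - a) / h" "(s - a) / h \<le> 1" using True False h by auto
      ultimately show ?thesis using False h by (simp add: clamp01_def)
    next
      case F: False
      then have "D = {a..<a + h}" using a by (auto simp: D_def)
      moreover have "1 \<le> (s - a) / h" using F h by simp
      ultimately show ?thesis using h by (simp add: clamp01_def)
    qed
  qed
  show "set_integrable lborel {t..s} (\<lambda>r. c * indicator {t + real i * h..<t + real (Suc i) * h} r)"
    unfolding set_integrable_def a(2) a_def[symmetric] ind
    using Dm fin by simp
  show "(LINT r:{t..s}|lborel. c * indicator {t + real i * h..<t + real (Suc i) * h} r) = c * (h * clamp01 ((s - (t + real i * h)) / h))"
    unfolding set_lebesgue_integral_def a(2) a_def[symmetric] ind
    using Dm fin by (simp add: meas)
qed

lemma set_integral_step_sum: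
  fixes c :: "nat \<Rightarrow> real"
  assumes h: "0 < h" and s: "t \<le> s"
  shows "set_integrable lborel {t..s} (\<lambda>r. \<Sum>i<N. c i * indicator {t + real i * h..<t + real (Suc i) * h} r)"
    "(LINT r:{t..s}|lborel. (\<Sum>i<N. c i * indicator {t + real i * h..<t + real (Suc i) * h} r))
      = (\<Sum>i<N. c i * (h * clamp01 ((s - (t + real i * h)) / h)))"
proof -
  have int: "integrable lborel (\<lambda>r. indicator {t..s} r *\<^sub>R (c i * indicator {t + real i * h..<t + real (Suc i) * h} r))" for i
    using set_integral_step(1)[OF h s] unfolding set_integrable_def .
  show "set_integrable lborel {t..s} (\<lambda>r. \<Sum>i<N. c i * indicator {t + real i * h..<t + real (Suc i) * h} r)"
    unfolding set_integrable_def scaleR_sum_right by (rule Bochner_Integration.integrable_sum) (rule int)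
  show "(LINT r:{t..s}|lborel. (\<Sum>i<N. c i * indicator {t + real i * h..<t + real (Suc i) * h} r))
      = (\<Sum>i<N. c i * (h * clamp01 ((s - (t + real i * h)) / h)))"
    unfolding set_lebesgue_integral_def scaleR_sum_right
    by (subst Bochner_Integration.integral_sum[OF int])
      (use set_integral_step(2)[OF h s] in \<open>simp only: set_lebesgue_integral_def\<close>)
qed

lemma interpolation_velocity_integral:
  assumes h: "0 < h" and s: "t \<le> s"
  shows "(LINT r:{t..s}|lborel. interpolation_velocity w t h N r) = linear_interpolation w t h N s - w t"
  unfolding interpolation_velocity_def set_integral_step_sum(2)[OF h s]
  using h by (simp add: linear_interpolation_def)

text \<open>The cells are disjoint, so the mixed products vanish.\<close>
lemma interpolation_velocity_power2:
  assumes h: "0 < h"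
  shows "(interpolation_velocity w t h N s)\<^sup>2
    = (\<Sum>i<N. ((w (t + real (Suc i) * h) - w (t + real i * h)) / h)\<^sup>2 * indicator {t + real i * h..<t + real (Suc i) * h} s)"
proof -
  define I where "I = (\<lambda>i. {t + real i * h..<t + real (Suc i) * h})"
  define a where "a = (\<lambda>i. (w (t + real (Suc i) * h) - w (t + real i * h)) / h)"
  have disj: "i = j" if "s \<in> I i" "s \<in> I j" for i j
  proof -
    have "real i * h < real (Suc j) * h" "real j * h < real (Suc i) * h" using that by (auto simp: I_def)
    then have "real i < real (Suc j)" "real j < real (Suc i)" using h by (auto simp: mult_less_cancel_right)
    then show ?thesis by linarith
  qed
  have v: "interpolation_velocity w t h N s = (\<Sum>i<N. a i * indicator (I i) s)"
    unfolding interpolation_velocity_def a_def I_def ..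
  have "(interpolation_velocity w t h N s)\<^sup>2 = (\<Sum>i<N. (a i)\<^sup>2 * indicator (I i) s)"
  proof (cases "\<exists>j<N. s \<in> I j")
    case True
    then obtain j where j: "j < N" "s \<in> I j" by blast
    have "indicator (I i) s = (if i = j then 1 else 0 :: real)" for i
    proof (cases "i = j")
      case False
      then have "s \<notin> I i" using disj j(2) by blast
      then show ?thesis using False by simp
    qed (use j in simp)
    then have "(\<Sum>i<N. c i * indicator (I i) s) = c j" for c :: "nat \<Rightarrow> real"
      using j(1) by (simp only: if_distrib[of "\<lambda>x. _ * x"] mult_1_right mult_zero_right) (simp cong: if_cong)
    then show ?thesis unfolding v by simp
  next
    case False
    then have "(\<Sum>i<N. c i * indicator (I i) s) = 0" for c :: "nat \<Rightarrow> real"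
      by (intro sum.neutral) auto
    then show ?thesis unfolding v by simp
  qed
  then show ?thesis unfolding a_def I_def .
qed

lemma L2_on_interpolation_velocity:
  assumes h: "0 < h" and N: "real N * h = T - t" and tT: "t < T"
  shows "L2_on t T (interpolation_velocity w t h N)"
    "(LINT s:{t..T}|lborel. (interpolation_velocity w t h N s)\<^sup>2)
      = (\<Sum>i<N. (w (t + real (Suc i) * h) - w (t + real i * h))\<^sup>2 / h)"
proof -
  have tT': "t \<le> T" using tT by simp
  have "set_integrable lborel {t..T} (interpolation_velocity w t h N)"
    unfolding interpolation_velocity_def[abs_def] by (rule set_integral_step_sum(1)[OF h tT'])
  moreover have "set_integrable lborel {t..T} (\<lambda>s. (interpolation_velocity w t h N s)\<^sup>2)"
    unfolding interpolation_velocity_power2[OF h] by (rule set_integral_step_sum(1)[OF h tT'])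
  ultimately show "L2_on t T (interpolation_velocity w t h N)"
    unfolding L2_on_def set_integrable_def set_borel_measurable_def by (blast intro: borel_measurable_integrable)
  have "clamp01 ((T - (t + real i * h)) / h) = 1" if "i < N" for i
  proof -
    have "t + real (Suc i) * h \<le> T" using that by (intro grid_le[OF h N]) auto
    then have "1 \<le> (T - (t + real i * h)) / h" using h by (simp add: field_simps)
    then show ?thesis by (simp add: clamp01_def)
  qed
  then show "(LINT s:{t..T}|lborel. (interpolation_velocity w t h N s)\<^sup>2)
      = (\<Sum>i<N. (w (t + real (Suc i) * h) - w (t + real i * h))\<^sup>2 / h)"
    unfolding interpolation_velocity_power2[OF h] set_integral_step_sum(2)[OF h tT']
    using h by (intro sum.cong) (auto simp: power2_eq_square)
qed

text \<open>Young's inequality; the weight will be \<open>k = sqrt \<epsilon>\<close>, which makes the main term almost sharp.\<close>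
lemma weighted_square_sum_le:
  fixes u e k :: real
  assumes k: "0 < k"
  shows "(u + e)\<^sup>2 \<le> (1 + k) * u\<^sup>2 + (1 + 1 / k) * e\<^sup>2"
proof -
  have "0 \<le> (sqrt k * u - e / sqrt k)\<^sup>2" by simp
  also have "(sqrt k * u - e / sqrt k)\<^sup>2 = k * u\<^sup>2 + e\<^sup>2 / k - 2 * u * e"
    using k by (simp add: power2_diff power_mult_distrib power_divide)
  finally show ?thesis by (simp add: power2_sum algebra_simps add_divide_distrib)
qed

text \<open>Subtracting the bridges \<open>B\<close> of the noise from the solution gives the path \<open>Y - k B\<close>, with velocity
\<open>f = b (Y s) s + k v\<close> where \<open>v\<close> is the velocity of the interpolated noise. It has the end point
\<open>Y T\<close> because \<open>B T = 0\<close>, hence is admissible, and \<open>f\<close> differs from the drift along it by \<open>k v\<close>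
and an error of size at most \<open>A k \<bar>B\<bar>\<close>.\<close>
lemma q_cost_le_interpolated_noise:
  assumes b: "drift_bound b T A" and A: "0 \<le> A" and by2: "L2_on t T (b y)"
    and h: "0 < h" and N: "real N * h = T - t" and tT: "t < T" and k: "0 < k"
    and w: "continuous_on {t..T} w" and Y: "continuous_on {t..T} Y"
    and eq: "\<And>s. s \<in> {t..T} \<Longrightarrow> Y s = y + (LINT r:{t..s}|lborel. b (Y r) r) + k * (w s - w t)"
    and x: "x \<le> Y T"
  shows "q_cost b T x y t \<le> k\<^sup>2 / 2 * ((1 + k) * (\<Sum>i<N. (w (t + real (Suc i) * h) - w (t + real i * h))\<^sup>2 / h)
     + (1 + 1 / k) * A\<^sup>2 * (LINT s:{t..T}|lborel. (w s - linear_interpolation w t h N s)\<^sup>2))"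
proof -
  define v where "v = interpolation_velocity w t h N"
  define B where "B = (\<lambda>s. w s - linear_interpolation w t h N s)"
  define f where "f = (\<lambda>s. b (Y s) s + k * v s)"
  have Bc: "continuous_on {t..T} B"
    unfolding B_def by (intro continuous_intros w continuous_on_linear_interpolation h)
  have v2: "L2_on t T v" and vint: "(LINT s:{t..T}|lborel. (v s)\<^sup>2) = (\<Sum>i<N. (w (t + real (Suc i) * h) - w (t + real i * h))\<^sup>2 / h)"
    unfolding v_def by (rule L2_on_interpolation_velocity[OF h N tT])+
  have v2i: "set_integrable lborel {t..T} (\<lambda>s. (v s)\<^sup>2)" using v2 by (simp add: L2_on_def)
  have B2i: "set_integrable lborel {t..T} (\<lambda>s. (B s)\<^sup>2)"
    by (intro set_integrable_continuous continuous_intros Bc)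
  have kv: "L2_on t T (\<lambda>s. k * v s)"
    using v2 unfolding L2_on_def set_borel_measurable_def
    by (auto simp: power_mult_distrib mult.left_commute)
  have bY: "L2_on t T (\<lambda>s. b (Y s) s)" by (rule L2_on_drift_along_path[OF b by2 Y])
  have f: "L2_on t T f" unfolding f_def by (rule L2_on_add[OF bY kv])
  have path: "path_of y t f s = Y s - k * B s" if s: "s \<in> {t..T}" for s
  proof -
    have i: "set_integrable lborel {t..s} (\<lambda>r. b (Y r) r)" "set_integrable lborel {t..s} (\<lambda>r. k * v r)"
      using s by (auto intro: set_integrable_subset[OF L2_on_imp_set_integrable[OF bY]]
        set_integrable_subset[OF L2_on_imp_set_integrable[OF kv]])
    have "path_of y t f s = y + (LINT r:{t..s}|lborel. b (Y r) r) + k * (LINT r:{t..s}|lborel. v r)"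
      unfolding path_of_def f_def by (simp add: set_integral_add(2)[OF i])
    also have "(LINT r:{t..s}|lborel. v r) = linear_interpolation w t h N s - w t"
      unfolding v_def by (rule interpolation_velocity_integral[OF h]) (use s in auto)
    finally show ?thesis using eq[OF s] by (simp add: B_def algebra_simps)
  qed
  have "B T = 0"
  proof -
    have "0 < N" using N tT by (cases N) auto
    then obtain j where j: "N = Suc j" by (metis gr0_implies_Suc)
    have T: "T = t + real j * h + 1 * h" "T = t + real (Suc j) * h" using N by (auto simp: j algebra_simps)
    have "linear_interpolation w t h N T = w T"
      unfolding T(1) using linear_interpolation_cell[OF h, of j N 1 w t] T[symmetric] j by simp
    then show ?thesis by (simp add: B_def)
  qed
  then have "path_of y t f T = Y T" using path[of T] tT by simp
  then have "q_cost b T x y t \<le> action b y t T f" by (intro q_cost_le_action f) (simp add: x)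
  also have "action b y t T f \<le> 1 / 2 * (LINT s:{t..T}|lborel. (1 + k) * k\<^sup>2 * (v s)\<^sup>2 + (1 + 1 / k) * (A\<^sup>2 * k\<^sup>2) * (B s)\<^sup>2)"
    unfolding action_def
  proof (intro mult_left_mono set_integral_mono_nonneg)
    fix s assume s: "s \<in> {t..T}"
    have "\<bar>b (Y s) s - b (path_of y t f s) s\<bar> \<le> A * \<bar>Y s - path_of y t f s\<bar>"
      by (rule drift_lipschitz[OF b]) (use s in simp)
    also have "\<dots> = A * k * \<bar>B s\<bar>" using k by (simp add: path[OF s] abs_mult)
    finally have "(b (Y s) s - b (path_of y t f s) s)\<^sup>2 \<le> (A * k * \<bar>B s\<bar>)\<^sup>2"
      using abs_le_square_iff A k by (metis abs_ge_zero abs_of_nonneg mult_nonneg_nonneg less_imp_le)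
    also have "\<dots> = A\<^sup>2 * k\<^sup>2 * (B s)\<^sup>2" by (simp add: power_mult_distrib)
    finally have e: "(b (Y s) s - b (path_of y t f s) s)\<^sup>2 \<le> A\<^sup>2 * k\<^sup>2 * (B s)\<^sup>2" .
    have "(f s - b (path_of y t f s) s)\<^sup>2 = (k * v s + (b (Y s) s - b (path_of y t f s) s))\<^sup>2"
      by (simp add: f_def algebra_simps)
    also have "\<dots> \<le> (1 + k) * (k * v s)\<^sup>2 + (1 + 1 / k) * (b (Y s) s - b (path_of y t f s) s)\<^sup>2"
      by (rule weighted_square_sum_le[OF k])
    also have "\<dots> \<le> (1 + k) * (k * v s)\<^sup>2 + (1 + 1 / k) * (A\<^sup>2 * k\<^sup>2 * (B s)\<^sup>2)"
      using k e by (intro add_left_mono mult_left_mono) auto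
    finally show "(f s - b (path_of y t f s) s)\<^sup>2 \<le> (1 + k) * k\<^sup>2 * (v s)\<^sup>2 + (1 + 1 / k) * (A\<^sup>2 * k\<^sup>2) * (B s)\<^sup>2"
      by (simp add: power_mult_distrib mult.assoc)
    show "0 \<le> (1 + k) * k\<^sup>2 * (v s)\<^sup>2 + (1 + 1 / k) * (A\<^sup>2 * k\<^sup>2) * (B s)\<^sup>2"
      using k by (intro add_nonneg_nonneg mult_nonneg_nonneg) auto
  next
    show "set_integrable lborel {t..T} (\<lambda>s. (1 + k) * k\<^sup>2 * (v s)\<^sup>2 + (1 + 1 / k) * (A\<^sup>2 * k\<^sup>2) * (B s)\<^sup>2)"
      by (intro set_integral_add(1) set_integrable_mult_right v2i B2i)
  qed simp
  also have "(LINT s:{t..T}|lborel. (1 + k) * k\<^sup>2 * (v s)\<^sup>2 + (1 + 1 / k) * (A\<^sup>2 * k\<^sup>2) * (B s)\<^sup>2)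
     = (1 + k) * k\<^sup>2 * (LINT s:{t..T}|lborel. (v s)\<^sup>2) + (1 + 1 / k) * (A\<^sup>2 * k\<^sup>2) * (LINT s:{t..T}|lborel. (B s)\<^sup>2)"
    using v2i B2i by (subst set_integral_add(2)) (auto intro!: set_integrable_mult_right simp only: set_integral_mult_right)
  finally show ?thesis unfolding vint B_def by (simp add: algebra_simps)
qed

text \<open>Midpoints of a refinement of every block into \<open>n\<close> cells are used as tags, so that the offsets
\<open>(j + 1/2) / n\<close> are strictly between \<open>0\<close> and \<open>1\<close> and the bridge has a nondegenerate law there. All
blocks share the same offsets, so that one offset can be fixed for all blocks at once.\<close>
lemma bridge_integral_riemann:
  assumes h: "0 < h" and N: "real N * h = T - t" and tT: "t < T" and w: "continuous_on {t..T} w"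
  defines "D \<equiv> \<lambda>i r. (1 - r) * (w (t + real i * h + r * h) - w (t + real i * h))
     - r * (w (t + real (Suc i) * h) - w (t + real i * h + r * h))"
  shows "(\<lambda>n. h / real n * (\<Sum>j<n. \<Sum>i<N. (D i ((real j + 1/2) / real n))\<^sup>2))
    \<longlonglongrightarrow> (LINT s:{t..T}|lborel. (w s - linear_interpolation w t h N s)\<^sup>2)"
proof -
  define g where "g = (\<lambda>s. (w s - linear_interpolation w t h N s)\<^sup>2)"
  have Npos: "0 < N" using N tT by (cases N) auto
  have gc: "continuous_on {t..T} g"
    unfolding g_def by (intro continuous_intros w continuous_on_linear_interpolation h)
  have "(\<lambda>m. (T - t) / real m * (\<Sum>k<m. g (t + (real k + 1/2) * ((T - t) / real m)))) \<longlonglongrightarrow> (LINT s:{t..T}|lborel. g s)"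
    by (rule riemann_sums_tendsto_integral[OF gc tT]) auto
  moreover have "filterlim (\<lambda>n. N * n) sequentially sequentially"
    using Npos by (intro filterlim_subseq) (simp add: strict_mono_def)
  ultimately have lim: "(\<lambda>n. (T - t) / real (N * n) * (\<Sum>k<N * n. g (t + (real k + 1/2) * ((T - t) / real (N * n)))))
      \<longlonglongrightarrow> (LINT s:{t..T}|lborel. g s)"
    by (rule filterlim_compose)
  have "(T - t) / real (N * n) * (\<Sum>k<N * n. g (t + (real k + 1/2) * ((T - t) / real (N * n))))
      = h / real n * (\<Sum>j<n. \<Sum>i<N. (D i ((real j + 1/2) / real n))\<^sup>2)" if n: "0 < n" for n
  proof -
    have hn: "(T - t) / real (N * n) = h / real n" using N[symmetric] Npos by simp
    have cell: "g (t + (real (i * n + j) + 1/2) * (h / real n)) = (D i ((real j + 1/2) / real n))\<^sup>2"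
      if "i < N" "j < n" for i j
    proof -
      define r where "r = (real j + 1/2) / real n"
      have r: "0 \<le> r" "r \<le> 1" using that by (auto simp: r_def)
      have p: "t + (real (i * n + j) + 1/2) * (h / real n) = t + real i * h + r * h"
        using n by (simp add: r_def field_simps)
      have "w (t + real i * h + r * h) - linear_interpolation w t h N (t + real i * h + r * h) = D i r"
        unfolding linear_interpolation_cell[OF h that(1) r] D_def by (simp add: algebra_simps)
      then show ?thesis unfolding p g_def r_def[symmetric] by simp
    qed
    have "(\<Sum>k<N * n. g (t + (real k + 1/2) * (h / real n)))
        = (\<Sum>i<N. \<Sum>k\<in>{i * n..<i * n + n}. g (t + (real k + 1/2) * (h / real n)))"
      by (rule sum.nat_group[symmetric])
    also have "\<dots> = (\<Sum>i<N. \<Sum>j<n. g (t + (real (i * n + j) + 1/2) * (h / real n)))"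
    proof (rule sum.cong[OF refl])
      fix i
      show "(\<Sum>k\<in>{i * n..<i * n + n}. g (t + (real k + 1/2) * (h / real n)))
         = (\<Sum>j<n. g (t + (real (i * n + j) + 1/2) * (h / real n)))"
        by (rule sum.reindex_bij_witness[of _ "\<lambda>j. i * n + j" "\<lambda>k. k - i * n"]) auto
    qed
    also have "\<dots> = (\<Sum>i<N. \<Sum>j<n. (D i ((real j + 1/2) / real n))\<^sup>2)"
      by (intro sum.cong refl cell) auto
    also have "\<dots> = (\<Sum>j<n. \<Sum>i<N. (D i ((real j + 1/2) / real n))\<^sup>2)" by (rule sum.swap)
    finally show ?thesis unfolding hn by simp
  qed
  then have "\<forall>\<^sub>F n in sequentially. (T - t) / real (N * n) * (\<Sum>k<N * n. g (t + (real k + 1/2) * ((T - t) / real (N * n))))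
      = h / real n * (\<Sum>j<n. \<Sum>i<N. (D i ((real j + 1/2) / real n))\<^sup>2)"
    by (intro eventually_sequentiallyI[of 1]) auto
  from Lim_transform_eventually[OF lim this] show ?thesis unfolding g_def .
qed

section \<open>Upper bound on the probability of exceeding the level\<close>
lemma brownian_increment_distributed:
  assumes "brownian_motion_on M t T W" "t \<le> r" "r < s" "s \<le> T"
  shows "distributed M lborel (\<lambda>\<omega>. W s \<omega> - W r \<omega>) (normal_density 0 (sqrt (s - r)))"
  using assms unfolding brownian_motion_on_def by blast

lemma brownian_increments_indep:
  assumes bm: "brownian_motion_on M t T W"
    and "\<And>i. i \<le> n \<Longrightarrow> t \<le> \<tau> i \<and> \<tau> i \<le> T" "\<And>i. i < n \<Longrightarrow> \<tau> i \<le> \<tau> (Suc i)"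
  shows "prob_space.indep_vars M (\<lambda>_. borel) (\<lambda>i \<omega>. W (\<tau> (Suc i)) \<omega> - W (\<tau> i) \<omega>) {..<n}"
  using assms unfolding brownian_motion_on_def by auto

text \<open>The deviation of \<open>w\<close> from its chord over cell \<open>i\<close>, at the fraction \<open>r\<close> of the cell, written in terms of
the two increments that meet there because these are independent for Brownian motion.\<close>
definition bridge :: "(real \<Rightarrow> real) \<Rightarrow> real \<Rightarrow> real \<Rightarrow> nat \<Rightarrow> real \<Rightarrow> real" where
  "bridge w t h i r = (1 - r) * (w (t + real i * h + r * h) - w (t + real i * h))
     - r * (w (t + real (Suc i) * h) - w (t + real i * h + r * h))"

lemma brownian_bridge_exp_quadratic_moment:
  assumes bm: "brownian_motion_on M t T W" and r: "0 < r" "r < 1"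
    and h: "0 < h" and N: "real N * h = T - t" and \<epsilon>: "0 < \<epsilon>" and \<mu>: "\<mu> * h \<le> 2"
  shows "(\<integral>\<^sup>+\<omega>. ennreal (exp (\<Sum>i<N. (1 - \<epsilon>) * (W (t + real (Suc i) * h) \<omega> - W (t + real i * h) \<omega>)\<^sup>2 / (2 * h)
      + \<mu> * (bridge (\<lambda>s. W s \<omega>) t h i r)\<^sup>2 / 2)) \<partial>M) \<le> ennreal (sqrt (2 / \<epsilon>) ^ N)"
proof -
  interpret prob_space M using bm by (simp add: brownian_motion_on_def)
  \<comment> \<open>The block ends interleaved with the points at offset \<open>r\<close>, so that block \<open>i\<close> owns the
    increments \<open>2 * i\<close> and \<open>2 * i + 1\<close>.\<close>
  define \<tau> where "\<tau> = (\<lambda>j. if even j then t + real (j div 2) * h else t + real (j div 2) * h + r * h)"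
  define X where "X = (\<lambda>j \<omega>. W (\<tau> (Suc j)) \<omega> - W (\<tau> j) \<omega>)"
  have \<tau>_even: "\<tau> (2 * i) = t + real i * h" and \<tau>_odd: "\<tau> (2 * i + 1) = t + real i * h + r * h"
    and \<tau>_next: "\<tau> (Suc (2 * i + 1)) = t + real (Suc i) * h" for i
    by (simp_all add: \<tau>_def)
  have rh: "0 < r * h" "r * h < h" using r h by auto
  have step: "\<tau> j \<le> \<tau> (Suc j)" for j
  proof (cases "even j")
    case True
    then obtain i where "j = 2 * i" by (elim evenE)
    then show ?thesis using \<tau>_even[of i] \<tau>_odd[of i] rh by simp
  next
    case False
    then obtain i where "j = 2 * i + 1" by (elim oddE)
    moreover have "t + real i * h + r * h \<le> t + real (Suc i) * h" using r h by (simp add: distrib_right)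
    ultimately show ?thesis using \<tau>_odd[of i] \<tau>_next[of i] by metis
  qed
  then have mono: "\<tau> i \<le> \<tau> j" if "i \<le> j" for i j using that by (rule lift_Suc_mono_le)
  have "indep_vars (\<lambda>_. borel) X {..<2 * N}"
    unfolding X_def
  proof (rule brownian_increments_indep[OF bm])
    fix j assume "j \<le> 2 * N"
    then show "t \<le> \<tau> j \<and> \<tau> j \<le> T"
      using mono[of 0 j] mono[of j "2 * N"] \<tau>_even[of 0] \<tau>_even[of N] N by simp
  qed (rule step)
  moreover have "distributed M lborel (X (2 * i)) (normal_density 0 (sqrt (r * h)))"
    "distributed M lborel (X (2 * i + 1)) (normal_density 0 (sqrt ((1 - r) * h)))" if i: "i < N" for i
  proof -
    have le: "t + real (Suc i) * h \<le> T" using i by (intro grid_le[OF h N]) simp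
    have e: "t + real (Suc i) * h = t + real i * h + h" by (simp add: algebra_simps)
    have p: "0 \<le> real i * h" using h by simp
    have X1: "X (2 * i) = (\<lambda>\<omega>. W (t + real i * h + r * h) \<omega> - W (t + real i * h) \<omega>)"
      using \<tau>_even[of i] \<tau>_odd[of i] by (simp add: X_def)
    have X2: "X (2 * i + 1) = (\<lambda>\<omega>. W (t + real (Suc i) * h) \<omega> - W (t + real i * h + r * h) \<omega>)"
      unfolding X_def \<tau>_next \<tau>_odd ..
    show "distributed M lborel (X (2 * i)) (normal_density 0 (sqrt (r * h)))"
      unfolding X1
      using brownian_increment_distributed[OF bm, of "t + real i * h" "t + real i * h + r * h"] rh le e p by simp
    have d: "t + real (Suc i) * h - (t + real i * h + r * h) = (1 - r) * h" by (simp add: algebra_simps)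
    show "distributed M lborel (X (2 * i + 1)) (normal_density 0 (sqrt ((1 - r) * h)))"
      unfolding X2 d[symmetric]
      by (rule brownian_increment_distributed[OF bm]) (use rh le e p in linarith)+
  qed
  ultimately have "(\<integral>\<^sup>+\<omega>. ennreal (exp (\<Sum>i<N. (1 - \<epsilon>) * (X (2 * i) \<omega> + X (2 * i + 1) \<omega>)\<^sup>2 / (2 * h)
      + \<mu> * ((1 - r) * X (2 * i) \<omega> - r * X (2 * i + 1) \<omega>)\<^sup>2 / 2)) \<partial>M) \<le> ennreal (sqrt (2 / \<epsilon>) ^ N)"
    by (intro indep_pair_bridge_exp_quadratic_moment r h \<epsilon> \<mu>)
  moreover have "X (2 * i) \<omega> + X (2 * i + 1) \<omega> = W (t + real (Suc i) * h) \<omega> - W (t + real i * h) \<omega>"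
    "(1 - r) * X (2 * i) \<omega> - r * X (2 * i + 1) \<omega> = bridge (\<lambda>s. W s \<omega>) t h i r" for i \<omega>
    using \<tau>_even[of i] \<tau>_odd[of i] \<tau>_next[of i] by (simp_all add: X_def bridge_def)
  ultimately show ?thesis by simp
qed

lemma exp_average_le:
  fixes g :: "nat \<Rightarrow> real"
  assumes "0 < n"
  shows "exp ((\<Sum>j<n. g j) / real n) \<le> (\<Sum>j<n. exp (g j)) / real n"
proof -
  have "exp (\<Sum>j<n. (1 / real n) *\<^sub>R g j) \<le> (\<Sum>j<n. (1 / real n) * exp (g j))"
    by (rule convex_on_sum[OF _ _ exp_convex]) (use assms in auto)
  then show ?thesis by (simp add: sum_divide_distrib)
qed

text \<open>Replace the integral of the squared bridges by Riemann sums, which are averages over the offset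
\<open>\<rho> n j\<close>. Jensen's inequality moves the average outside the exponential, where every offset obeys the
same bound; Fatou's lemma passes to the limit.\<close>
lemma brownian_path_exp_quadratic_moment:
  assumes bm: "brownian_motion_on M t T W" and tT: "t < T"
    and h: "0 < h" and N: "real N * h = T - t" and \<epsilon>: "0 < \<epsilon>" and \<mu>: "\<mu> * h \<le> 2" "0 \<le> \<mu>"
    and \<Phi>: "\<Phi> \<in> borel_measurable M"
    and bound: "AE \<omega> in M. \<Phi> \<omega> \<le> (\<Sum>i<N. (1 - \<epsilon>) * (W (t + real (Suc i) * h) \<omega> - W (t + real i * h) \<omega>)\<^sup>2 / (2 * h))
      + \<mu> / (2 * h) * (LINT s:{t..T}|lborel. (W s \<omega> - linear_interpolation (\<lambda>s. W s \<omega>) t h N s)\<^sup>2)"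
  shows "(\<integral>\<^sup>+\<omega>. ennreal (exp (\<Phi> \<omega>)) \<partial>M) \<le> ennreal (sqrt (2 / \<epsilon>) ^ N)"
proof -
  interpret prob_space M using bm by (simp add: brownian_motion_on_def)
  have Wm[measurable]: "W s \<in> borel_measurable M" if "t \<le> s" "s \<le> T" for s
    using bm that by (simp add: brownian_motion_on_def)
  define S where "S = (\<lambda>\<omega>. \<Sum>i<N. (1 - \<epsilon>) * (W (t + real (Suc i) * h) \<omega> - W (t + real i * h) \<omega>)\<^sup>2 / (2 * h))"
  define Q where "Q = (\<lambda>r \<omega>. \<Sum>i<N. (bridge (\<lambda>s. W s \<omega>) t h i r)\<^sup>2)"
  define I where "I = (\<lambda>\<omega>. LINT s:{t..T}|lborel. (W s \<omega> - linear_interpolation (\<lambda>s. W s \<omega>) t h N s)\<^sup>2)"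
  define \<rho> where "\<rho> = (\<lambda>n j. (real j + 1/2) / real n)"
  define F where "F = (\<lambda>n \<omega>. S \<omega> + \<mu> / (2 * h) * (h / real n * (\<Sum>j<n. Q (\<rho> n j) \<omega>)))"
  have grid: "t \<le> t + real i * h" "t + real i * h \<le> T" if "i \<le> N" for i
    using grid_le[OF h N that] h by auto
  have grid': "t \<le> t + real i * h + r * h" "t + real i * h + r * h \<le> T" if "i < N" "0 < r" "r < 1" for i r
  proof -
    have "r * h \<le> 1 * h" using that h by (intro mult_right_mono) auto
    then show "t + real i * h + r * h \<le> T" using grid(2)[of "Suc i"] that by (simp add: algebra_simps)
    show "t \<le> t + real i * h + r * h" using h that by simp
  qed
  have Sm[measurable]: "S \<in> borel_measurable M"
    unfolding S_def
    by (intro borel_measurable_sum borel_measurable_divide borel_measurable_times borel_measurable_const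
        borel_measurable_power borel_measurable_diff Wm grid) auto
  have Qm: "Q r \<in> borel_measurable M" if "0 < r" "r < 1" for r
    unfolding Q_def bridge_def
    by (intro borel_measurable_sum borel_measurable_times borel_measurable_const
        borel_measurable_power borel_measurable_diff Wm grid grid') (use that in auto)
  have \<rho>: "0 < \<rho> n j" "\<rho> n j < 1" if "j < n" for n j
    using that by (auto simp: \<rho>_def)
  have Fm: "F n \<in> borel_measurable M" for n
    unfolding F_def
    by (intro borel_measurable_add Sm borel_measurable_times borel_measurable_const borel_measurable_sum Qm \<rho>) auto
  have F_bound: "(\<integral>\<^sup>+\<omega>. ennreal (exp (F n \<omega>)) \<partial>M) \<le> ennreal (sqrt (2 / \<epsilon>) ^ N)" if n: "0 < n" for n
  proof -
    define E where "E = (\<lambda>j \<omega>. S \<omega> + \<mu> / 2 * Q (\<rho> n j) \<omega>)"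
    have Em: "E j \<in> borel_measurable M" if "j < n" for j
      unfolding E_def using Qm[OF \<rho>[OF that]] by measurable
    have Eb: "(\<integral>\<^sup>+\<omega>. ennreal (exp (E j \<omega>)) \<partial>M) \<le> ennreal (sqrt (2 / \<epsilon>) ^ N)" if "j < n" for j
    proof -
      have "E j \<omega> = (\<Sum>i<N. (1 - \<epsilon>) * (W (t + real (Suc i) * h) \<omega> - W (t + real i * h) \<omega>)\<^sup>2 / (2 * h)
        + \<mu> * (bridge (\<lambda>s. W s \<omega>) t h i (\<rho> n j))\<^sup>2 / 2)" for \<omega>
        by (simp add: E_def S_def Q_def sum.distrib sum_distrib_left)
      then show ?thesis
        using brownian_bridge_exp_quadratic_moment[OF bm \<rho>[OF that] h N \<epsilon> \<mu>(1)] by simp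
    qed
    have "F n \<omega> = (\<Sum>j<n. E j \<omega>) / real n" for \<omega>
      using n h by (simp add: F_def E_def sum.distrib sum_distrib_left sum_divide_distrib add_divide_distrib)
    then have "exp (F n \<omega>) \<le> (\<Sum>j<n. exp (E j \<omega>)) / real n" for \<omega>
      using exp_average_le[OF n] by simp
    then have "(\<integral>\<^sup>+\<omega>. ennreal (exp (F n \<omega>)) \<partial>M) \<le> (\<integral>\<^sup>+\<omega>. ennreal (1 / real n) * (\<Sum>j<n. ennreal (exp (E j \<omega>))) \<partial>M)"
      by (intro nn_integral_mono) (simp add: sum_ennreal ennreal_mult[symmetric] sum_nonneg ennreal_leI)
    also have "\<dots> = ennreal (1 / real n) * (\<integral>\<^sup>+\<omega>. (\<Sum>j<n. ennreal (exp (E j \<omega>))) \<partial>M)"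
      by (rule nn_integral_cmult) (use Em in \<open>auto intro!: borel_measurable_sum\<close>)
    also have "(\<integral>\<^sup>+\<omega>. (\<Sum>j<n. ennreal (exp (E j \<omega>))) \<partial>M) = (\<Sum>j<n. \<integral>\<^sup>+\<omega>. ennreal (exp (E j \<omega>)) \<partial>M)"
      by (rule nn_integral_sum) (use Em in auto)
    also have "ennreal (1 / real n) * \<dots> \<le> ennreal (1 / real n) * (\<Sum>j<n. ennreal (sqrt (2 / \<epsilon>) ^ N))"
      by (intro mult_left_mono sum_mono Eb) auto
    also have "\<dots> = ennreal (1 / real n) * (ennreal (real n) * ennreal (sqrt (2 / \<epsilon>) ^ N))"
      by (simp add: ennreal_of_nat_eq_real_of_nat)
    also have "\<dots> = ennreal (sqrt (2 / \<epsilon>) ^ N)"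
      using n \<epsilon> by (subst ennreal_mult[symmetric], simp, simp, subst ennreal_mult[symmetric]) auto
    finally show ?thesis .
  qed
  have "AE \<omega> in M. continuous_on {t..T} (\<lambda>s. W s \<omega>)" using bm by (simp add: brownian_motion_on_def)
  then have "AE \<omega> in M. ennreal (exp (\<Phi> \<omega>)) \<le> liminf (\<lambda>n. ennreal (exp (F (Suc n) \<omega>)))"
    using bound
  proof eventually_elim
    case (elim \<omega>)
    have "(\<lambda>n. h / real n * (\<Sum>j<n. Q (\<rho> n j) \<omega>)) \<longlonglongrightarrow> I \<omega>"
      using bridge_integral_riemann[OF h N tT elim(1)] by (simp add: Q_def \<rho>_def bridge_def I_def)
    then have "(\<lambda>n. F n \<omega>) \<longlonglongrightarrow> S \<omega> + \<mu> / (2 * h) * I \<omega>"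
      unfolding F_def by (intro tendsto_intros)
    then have "(\<lambda>n. F (Suc n) \<omega>) \<longlonglongrightarrow> S \<omega> + \<mu> / (2 * h) * I \<omega>" by (rule LIMSEQ_Suc)
    then have "(\<lambda>n. ennreal (exp (F (Suc n) \<omega>))) \<longlonglongrightarrow> ennreal (exp (S \<omega> + \<mu> / (2 * h) * I \<omega>))"
      by (intro tendsto_ennrealI tendsto_exp)
    then have "liminf (\<lambda>n. ennreal (exp (F (Suc n) \<omega>))) = ennreal (exp (S \<omega> + \<mu> / (2 * h) * I \<omega>))"
      by (intro lim_imp_Liminf) auto
    then show ?case using elim(2) by (simp add: S_def I_def ennreal_leI)
  qed
  then have "(\<integral>\<^sup>+\<omega>. ennreal (exp (\<Phi> \<omega>)) \<partial>M) \<le> (\<integral>\<^sup>+\<omega>. liminf (\<lambda>n. ennreal (exp (F (Suc n) \<omega>))) \<partial>M)"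
    by (rule nn_integral_mono_AE)
  also have "\<dots> \<le> liminf (\<lambda>n. \<integral>\<^sup>+\<omega>. ennreal (exp (F (Suc n) \<omega>)) \<partial>M)"
    by (rule nn_integral_liminf) (use Fm in measurable)
  also have "\<dots> \<le> ennreal (sqrt (2 / \<epsilon>) ^ N)"
  proof (rule Liminf_le)
    show "\<forall>\<^sub>F n in sequentially. (\<integral>\<^sup>+\<omega>. ennreal (exp (F (Suc n) \<omega>)) \<partial>M) \<le> ennreal (sqrt (2 / \<epsilon>) ^ N)"
      using F_bound by simp
  qed simp
  finally show ?thesis .
qed

text \<open>Chebyshev's exponential inequality with the exponent \<open>(1 - k) q / \<epsilon>\<close> on the event \<open>Y T > x\<close>. The
factor \<open>1 - k\<close> leaves room: multiplied by the weight \<open>1 + k\<close> of the interpolated noise it becomes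
\<open>1 - \<epsilon>\<close>, just below the critical value \<open>1\<close> at which the Gaussian integral diverges.\<close>
lemma u_eps_upper_bound:
  assumes bm: "brownian_motion_on M t T W" and sol: "sde_solution M b \<epsilon> t T y W Y"
    and b: "drift_bound b T A" and A: "0 \<le> A" and by2: "L2_on t T (b y)" and tT: "t < T"
    and \<epsilon>: "0 < \<epsilon>" "\<epsilon> < 1" and h: "0 < h" and N: "real N * h = T - t" and Ah: "A\<^sup>2 * h\<^sup>2 \<le> 2 * sqrt \<epsilon>"
  shows "u_eps M Y T x \<le> sqrt (2 / \<epsilon>) ^ N * exp (- (1 - sqrt \<epsilon>) * q_cost b T x y t / \<epsilon>)"
proof -
  interpret prob_space M using bm by (simp add: brownian_motion_on_def)
  define k where "k = sqrt \<epsilon>"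
  have k: "0 < k" "k < 1" "k\<^sup>2 = \<epsilon>" using \<epsilon> by (auto simp: k_def)
  define q where "q = q_cost b T x y t"
  define \<mu> where "\<mu> = A\<^sup>2 * h / k"
  have \<mu>: "\<mu> * h \<le> 2" using Ah k by (simp add: \<mu>_def k_def power2_eq_square field_simps)
  have \<mu>0: "0 \<le> \<mu>" unfolding \<mu>_def using k h by (intro divide_nonneg_nonneg mult_nonneg_nonneg) auto
  define U where "U = {\<omega> \<in> space M. x < Y T \<omega>}"
  have [measurable]: "Y T \<in> borel_measurable M" using sol tT by (simp add: sde_solution_def)
  have [measurable]: "U \<in> sets M" unfolding U_def by measurable
  define \<Phi> where "\<Phi> = (\<lambda>\<omega>. (1 - k) * q / \<epsilon> * indicator U \<omega>)"
  have "AE \<omega> in M. continuous_on {t..T} (\<lambda>s. W s \<omega>)" using bm by (simp add: brownian_motion_on_def)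
  moreover have "AE \<omega> in M. continuous_on {t..T} (\<lambda>s. Y s \<omega>) \<and>
        set_integrable lborel {t..T} (\<lambda>r. b (Y r \<omega>) r) \<and>
        (\<forall>s\<in>{t..T}. Y s \<omega> = y + (LINT r:{t..s}|lborel. b (Y r \<omega>) r) + sqrt \<epsilon> * (W s \<omega> - W t \<omega>))"
    using sol by (simp add: sde_solution_def)
  ultimately have "AE \<omega> in M. \<Phi> \<omega> \<le> (\<Sum>i<N. (1 - \<epsilon>) * (W (t + real (Suc i) * h) \<omega> - W (t + real i * h) \<omega>)\<^sup>2 / (2 * h))
      + \<mu> / (2 * h) * (LINT s:{t..T}|lborel. (W s \<omega> - linear_interpolation (\<lambda>s. W s \<omega>) t h N s)\<^sup>2)"
  proof eventually_elim
    case (elim \<omega>)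
    define S where "S = (\<Sum>i<N. (W (t + real (Suc i) * h) \<omega> - W (t + real i * h) \<omega>)\<^sup>2 / h)"
    define I where "I = (LINT s:{t..T}|lborel. (W s \<omega> - linear_interpolation (\<lambda>s. W s \<omega>) t h N s)\<^sup>2)"
    have S0: "0 \<le> S" unfolding S_def using h by (intro sum_nonneg) auto
    have I0: "0 \<le> I" unfolding I_def set_lebesgue_integral_def by (intro integral_nonneg_AE) simp
    have rhs: "(\<Sum>i<N. (1 - \<epsilon>) * (W (t + real (Suc i) * h) \<omega> - W (t + real i * h) \<omega>)\<^sup>2 / (2 * h)) + \<mu> / (2 * h) * I
        = (1 - \<epsilon>) / 2 * S + A\<^sup>2 / (2 * k) * I"
      using h k by (simp add: S_def \<mu>_def sum_distrib_left)
    show ?case unfolding I_def[symmetric] rhs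
    proof (cases "\<omega> \<in> U")
      case True
      have "q \<le> k\<^sup>2 / 2 * ((1 + k) * S + (1 + 1 / k) * A\<^sup>2 * I)"
        unfolding q_def S_def I_def
        by (rule q_cost_le_interpolated_noise[OF b A by2 h N tT k(1) elim(1)])
          (use elim(2) True in \<open>auto simp: k_def U_def\<close>)
      then have "(1 - k) * q / \<epsilon> \<le> (1 - k) * (k\<^sup>2 / 2 * ((1 + k) * S + (1 + 1 / k) * A\<^sup>2 * I)) / \<epsilon>"
        using k \<epsilon> by (intro divide_right_mono mult_left_mono) auto
      also have "\<dots> = (1 - k) * (1 + k) / 2 * S + (1 - k) * (1 + k) / k / 2 * (A\<^sup>2 * I)"
        using k(1) \<epsilon> by (simp add: k(3) field_simps)
      also have "(1 - k) * (1 + k) = 1 - \<epsilon>" using k by (simp add: power2_eq_square algebra_simps)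
      also have "(1 - \<epsilon>) / k / 2 * (A\<^sup>2 * I) \<le> 1 / k / 2 * (A\<^sup>2 * I)"
        using k \<epsilon> I0 by (intro mult_right_mono divide_right_mono) auto
      finally show "\<Phi> \<omega> \<le> (1 - \<epsilon>) / 2 * S + A\<^sup>2 / (2 * k) * I"
        using True by (simp add: \<Phi>_def field_simps)
    next
      case False
      then show "\<Phi> \<omega> \<le> (1 - \<epsilon>) / 2 * S + A\<^sup>2 / (2 * k) * I"
        using S0 I0 \<epsilon> k by (simp add: \<Phi>_def)
    qed
  qed
  then have exp_moment: "(\<integral>\<^sup>+\<omega>. ennreal (exp (\<Phi> \<omega>)) \<partial>M) \<le> ennreal (sqrt (2 / \<epsilon>) ^ N)"
    by (intro brownian_path_exp_quadratic_moment[OF bm tT h N \<epsilon>(1) \<mu> \<mu>0]) (auto simp: \<Phi>_def)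
  have "ennreal (exp ((1 - k) * q / \<epsilon>) * prob U) = (\<integral>\<^sup>+\<omega>. ennreal (exp ((1 - k) * q / \<epsilon>)) * indicator U \<omega> \<partial>M)"
    by (subst nn_integral_cmult_indicator) (simp_all add: emeasure_eq_measure ennreal_mult)
  also have "\<dots> \<le> (\<integral>\<^sup>+\<omega>. ennreal (exp (\<Phi> \<omega>)) \<partial>M)"
    by (intro nn_integral_mono) (auto simp: \<Phi>_def indicator_def)
  also note exp_moment
  finally have "exp ((1 - k) * q / \<epsilon>) * prob U \<le> sqrt (2 / \<epsilon>) ^ N" using \<epsilon> by simp
  then have "exp (- ((1 - k) * q / \<epsilon>)) * (exp ((1 - k) * q / \<epsilon>) * prob U) \<le> exp (- ((1 - k) * q / \<epsilon>)) * sqrt (2 / \<epsilon>) ^ N"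
    by (rule mult_left_mono) simp
  also have "exp (- ((1 - k) * q / \<epsilon>)) * (exp ((1 - k) * q / \<epsilon>) * prob U) = prob U"
    by (simp add: mult.assoc[symmetric] exp_add[symmetric])
  also have "exp (- ((1 - k) * q / \<epsilon>)) * sqrt (2 / \<epsilon>) ^ N = sqrt (2 / \<epsilon>) ^ N * exp (- (1 - sqrt \<epsilon>) * q_cost b T x y t / \<epsilon>)"
    unfolding k_def q_def by (simp only: minus_divide_left minus_mult_left mult.commute)
  finally show ?thesis by (simp add: u_eps_def U_def)
qed

section \<open>Lower bound on the probability of exceeding the level\<close>
text \<open>The discrete estimate \<open>shifted_gaussian_walk_small_deviation\<close> is applied on uniform grids with \<open>n\<close>
steps; \<open>sum_squared_increments_le\<close> keeps its parameter \<open>K\<close> independent of \<open>n\<close>. If a path belongs to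
infinitely many of the grid events then the convergent Riemann sums satisfy the same bound in
the limit.\<close>
lemma brownian_shifted_small_deviation:
  assumes bm: "brownian_motion_on M t T W" and tT: "t < T" and k: "0 < k" and v: "L2_on t T v"
    and K: "0 < K" "(LINT s:{t..T}|lborel. (v s)\<^sup>2) \<le> k\<^sup>2 * K\<^sup>2"
    and G: "G \<in> sets M"
  defines "m \<equiv> 12 * exp ((T - t + 1) / 2)"
    and "P \<equiv> \<lambda>\<omega> s. k * (W s \<omega> - W t \<omega>) - (LINT r:{t..s}|lborel. v r)"
  assumes sub: "AE \<omega> in M. continuous_on {t..T} (P \<omega>) \<and>
      (LINT s:{t..T}|lborel. \<bar>P \<omega> s\<bar>) / (T - t) + \<bar>P \<omega> T\<bar> \<le> k * m \<longrightarrow> \<omega> \<in> G"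
  shows "exp (- K\<^sup>2 / 2 - K * m) / 2 \<le> measure M G"
proof -
  interpret prob_space M using bm by (simp add: brownian_motion_on_def)
  have Wm: "W s \<in> borel_measurable M" if "t \<le> s" "s \<le> T" for s
    using bm that by (simp add: brownian_motion_on_def)
  define H where "H = (\<lambda>s. LINT r:{t..s}|lborel. v r)"
  have H0: "H t = 0"
    using set_borel_integral_eq_integral(2)[OF set_integrable_subset[OF L2_on_imp_set_integrable[OF v]], of "{t..t}"] tT
    by (simp add: H_def)
  define R where "R = (\<lambda>n \<omega>. (\<Sum>j<n. \<bar>P \<omega> (t + real j * ((T - t) / real n))\<bar>) / real n + \<bar>P \<omega> T\<bar>)"
  define E where "E = (\<lambda>n. {\<omega> \<in> space M. R n \<omega> \<le> k * m})"
  have Hc: "continuous_on {t..T} H"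
    unfolding H_def by (rule continuous_on_indefinite_integral[OF L2_on_imp_set_integrable[OF v]])
  have E_sets: "E n \<in> events" for n
  proof -
    have pos: "t \<le> t + real j * ((T - t) / real n)" "t + real j * ((T - t) / real n) \<le> T" if "j < n" for j
      using grid_le[of "(T - t) / real n" n T t j] that tT by auto
    have Pm: "(\<lambda>\<omega>. P \<omega> s) \<in> borel_measurable M" if "t \<le> s" "s \<le> T" for s
      unfolding P_def using Wm[OF that] Wm[OF order_refl less_imp_le[OF tT]] by measurable
    have "R n \<in> borel_measurable M"
      unfolding R_def
      by (intro borel_measurable_add borel_measurable_divide borel_measurable_sum borel_measurable_abs
          borel_measurable_const Pm pos) (use tT in auto)
    then show ?thesis unfolding E_def by measurable
  qed
  have E_prob: "exp (- K\<^sup>2 / 2 - K * m) / 2 \<le> prob (E n)" if n: "0 < n" for n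
  proof -
    define h where "h = (T - t) / real n"
    have h: "0 < h" "real n * h = T - t" using tT n by (auto simp: h_def)
    define \<xi> where "\<xi> = (\<lambda>i \<omega>. W (t + real (Suc i) * h) \<omega> - W (t + real i * h) \<omega>)"
    define c where "c = (\<lambda>i. (H (t + real (Suc i) * h) - H (t + real i * h)) / k)"
    have ind: "indep_vars (\<lambda>_. borel) \<xi> {..<n}"
      unfolding \<xi>_def
    proof (rule brownian_increments_indep[OF bm, of n "\<lambda>i. t + real i * h"])
      show "t \<le> t + real i * h \<and> t + real i * h \<le> T" if "i \<le> n" for i
        using grid_le[OF h that] h by simp
      show "t + real i * h \<le> t + real (Suc i) * h" for i using h by (simp add: distrib_right)
    qed
    have dist: "distributed M lborel (\<xi> i) (normal_density 0 (sqrt h))" if "i < n" for i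
    proof -
      have e: "t + real (Suc i) * h - (t + real i * h) = h" by (simp add: algebra_simps)
      have "t + real (Suc i) * h \<le> T" using that by (intro grid_le[OF h]) simp
      then show ?thesis
        using brownian_increment_distributed[OF bm, of "t + real i * h" "t + real (Suc i) * h"] h e
        by (simp add: \<xi>_def)
    qed
    have "(\<Sum>i<n. (c i)\<^sup>2 / h) = (\<Sum>i<n. (H (t + real (Suc i) * h) - H (t + real i * h))\<^sup>2 / h) / k\<^sup>2"
      using k by (simp add: c_def power_divide sum_divide_distrib mult.commute)
    also have "\<dots> \<le> (LINT s:{t..T}|lborel. (v s)\<^sup>2) / k\<^sup>2"
      unfolding H_def h_def by (intro divide_right_mono sum_squared_increments_le[OF v tT n]) simp
    also have "\<dots> \<le> K\<^sup>2" using K(2) k by (simp add: field_simps)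
    finally have cK: "(\<Sum>i<n. (c i)\<^sup>2 / h) \<le> K\<^sup>2" .
    have S: "k * (\<Sum>i<j. \<xi> i \<omega> - c i) = P \<omega> (t + real j * h)" for j \<omega>
    proof -
      have "k * (\<Sum>i<j. \<xi> i \<omega> - c i)
        = (\<Sum>i<j. (k * W (t + real (Suc i) * h) \<omega> - H (t + real (Suc i) * h)) - (k * W (t + real i * h) \<omega> - H (t + real i * h)))"
        unfolding sum_distrib_left using k by (intro sum.cong) (auto simp: \<xi>_def c_def field_simps)
      also have "\<dots> = (k * W (t + real j * h) \<omega> - H (t + real j * h)) - (k * W (t + real 0 * h) \<omega> - H (t + real 0 * h))"
        by (rule sum_lessThan_telescope[of "\<lambda>i. k * W (t + real i * h) \<omega> - H (t + real i * h)"])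
      finally show ?thesis using H0 by (simp add: P_def H_def algebra_simps)
    qed
    have nh: "t + real n * h = T" using h by simp
    have "R n \<omega> = k * ((\<Sum>j<n. \<bar>\<Sum>i<j. \<xi> i \<omega> - c i\<bar>) / real n + \<bar>\<Sum>i<n. \<xi> i \<omega> - c i\<bar>)" for \<omega>
    proof -
      have "\<bar>P \<omega> (t + real j * h)\<bar> = k * \<bar>\<Sum>i<j. \<xi> i \<omega> - c i\<bar>" for j
        using k by (simp add: S[symmetric] abs_mult)
      from this this[of n, unfolded nh] show ?thesis
        unfolding R_def h_def[symmetric] by (simp add: distrib_left sum_distrib_left)
    qed
    then have "E n = {\<omega> \<in> space M. (\<Sum>j<n. \<bar>\<Sum>i<j. \<xi> i \<omega> - c i\<bar>) / real n + \<bar>\<Sum>i<n. \<xi> i \<omega> - c i\<bar> \<le> m}"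
      using k by (simp add: E_def)
    then show ?thesis
      using shifted_gaussian_walk_small_deviation[OF ind h(1) n _ dist K(1) cK, of "T - t"] h
      by (simp add: m_def)
  qed
  show ?thesis
  proof (rule prob_ge_of_infinitely_often[OF E_sets E_prob G])
    have "AE \<omega> in M. continuous_on {t..T} (\<lambda>s. W s \<omega>)" using bm by (simp add: brownian_motion_on_def)
    with sub show "AE \<omega> in M. (\<exists>\<^sub>\<infinity>n. \<omega> \<in> E n) \<longrightarrow> \<omega> \<in> G"
    proof eventually_elim
      case (elim \<omega>)
      have Pc: "continuous_on {t..T} (P \<omega>)"
        unfolding P_def using elim(2) Hc unfolding H_def by (intro continuous_intros) auto
      show ?case
      proof
        assume inf: "\<exists>\<^sub>\<infinity>n. \<omega> \<in> E n"
        have "(\<lambda>n. (T - t) / real n * (\<Sum>j<n. \<bar>P \<omega> (t + (real j + 0) * ((T - t) / real n))\<bar>))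
            \<longlonglongrightarrow> (LINT s:{t..T}|lborel. \<bar>P \<omega> s\<bar>)"
          by (rule riemann_sums_tendsto_integral[OF _ tT]) (auto intro!: continuous_intros Pc)
        then have "(\<lambda>n. (T - t) / real n * (\<Sum>j<n. \<bar>P \<omega> (t + (real j + 0) * ((T - t) / real n))\<bar>) / (T - t) + \<bar>P \<omega> T\<bar>)
            \<longlonglongrightarrow> (LINT s:{t..T}|lborel. \<bar>P \<omega> s\<bar>) / (T - t) + \<bar>P \<omega> T\<bar>"
          using tT by (intro tendsto_intros) auto
        moreover have "(T - t) / real n * (\<Sum>j<n. \<bar>P \<omega> (t + (real j + 0) * ((T - t) / real n))\<bar>) / (T - t) + \<bar>P \<omega> T\<bar> = R n \<omega>" for n
          using tT by (simp add: R_def)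
        ultimately have lim: "(\<lambda>n. R n \<omega>) \<longlonglongrightarrow> (LINT s:{t..T}|lborel. \<bar>P \<omega> s\<bar>) / (T - t) + \<bar>P \<omega> T\<bar>"
          by simp
        have "(LINT s:{t..T}|lborel. \<bar>P \<omega> s\<bar>) / (T - t) + \<bar>P \<omega> T\<bar> \<le> k * m"
        proof (rule ccontr)
          assume "\<not> ?thesis"
          then have "\<forall>\<^sub>F n in sequentially. k * m < R n \<omega>" using order_tendstoD(1)[OF lim] by simp
          then have "\<forall>\<^sub>\<infinity>n. \<omega> \<notin> E n"
            unfolding cofinite_eq_sequentially by eventually_elim (simp add: E_def)
          then show False using inf by (simp add: frequently_def)
        qed
        then show "\<omega> \<in> G" using elim(1) Pc by blast
      qed
    qed
  qed
qed

lemma exists_nearly_optimal_control: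
  assumes tT: "t < T" and e: "0 < e"
  obtains f where "L2_on t T f" "x \<le> path_of y t f T" "action b y t T f < q_cost b T x y t + e"
proof -
  have "\<exists>f\<in>{f. L2_on t T f \<and> path_of y t f T \<ge> x}. action b y t T f < q_cost b T x y t + e"
  proof (rule ccontr)
    assume "\<not> ?thesis"
    then have "q_cost b T x y t + e \<le> q_cost b T x y t"
      unfolding q_cost_def[of b T x y t, symmetric]
      by (subst (2) q_cost_def) (rule cINF_greatest, use constant_control(1,3)[OF tT, where x = x and y = y] in \<open>auto simp: not_less\<close>)
    then show False using e by simp
  qed
  then show ?thesis using that by blast
qed

lemma continuous_on_path_of: "L2_on t T f \<Longrightarrow> continuous_on {t..T} (path_of y t f)"
  unfolding path_of_def[abs_def]
  by (intro continuous_intros continuous_on_indefinite_integral L2_on_imp_set_integrable)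

text \<open>Raising the velocity by the constant \<open>k z / (T - t)\<close> changes the deviation from the drift by \<open>O(k)\<close>,
and Young's inequality with weight \<open>k\<close> turns this into a relative error \<open>k\<close> and an additive error
\<open>O(k)\<close> in the action.\<close>
lemma overshooting_control:
  assumes b: "drift_bound b T A" and A: "0 \<le> A" and by2: "L2_on t T (b y)" and tT: "t < T"
    and k: "0 < k" and f: "L2_on t T f" and z: "0 \<le> z"
  defines "f' \<equiv> \<lambda>s. f s + k * z / (T - t)"
  shows "L2_on t T f'" "path_of y t f' T = path_of y t f T + k * z"
    "action b y t T f' \<le> (1 + k) * action b y t T f + (k + k\<^sup>2) * (z / (T - t) + A * z)\<^sup>2 * (T - t) / 2"
proof -
  define \<tau> where "\<tau> = T - t"
  have \<tau>: "0 < \<tau>" using tT by (simp add: \<tau>_def)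
  define d where "d = k * z / \<tau>"
  have d: "0 \<le> d" using k z \<tau> by (simp add: d_def)
  have f'_def': "f' = (\<lambda>s. f s + d)" by (simp add: f'_def d_def \<tau>_def)
  show f': "L2_on t T f'" unfolding f'_def by (intro L2_on_add f L2_on_continuous) simp
  have path: "path_of y t f' s = path_of y t f s + (s - t) * d" if s: "s \<in> {t..T}" for s
  proof -
    have "set_integrable lborel {t..s} f"
      by (rule set_integrable_subset[OF L2_on_imp_set_integrable[OF f]]) (use s in auto)
    then have "(LINT r:{t..s}|lborel. f' r) = (LINT r:{t..s}|lborel. f r) + (LINT r:{t..s}|lborel. d)"
      unfolding f'_def' by (rule set_integral_add(2)) (simp add: set_integrable_continuous)
    also have "(LINT r:{t..s}|lborel. d) = (s - t) * d" using s by (simp add: set_lebesgue_integral_def)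
    finally show ?thesis by (simp add: path_of_def)
  qed
  show "path_of y t f' T = path_of y t f T + k * z"
    using path[of T] tT \<tau> by (simp add: d_def \<tau>_def)
  define v where "v = (\<lambda>s. f s - b (path_of y t f s) s)"
  have v: "L2_on t T v"
    unfolding v_def by (intro L2_on_diff f L2_on_drift_along_path[OF b by2] continuous_on_path_of)
  define c where "c = z / \<tau> + A * z"
  have vi: "set_integrable lborel {t..T} (\<lambda>s. (v s)\<^sup>2)" using v by (simp add: L2_on_def)
  have ci: "set_integrable lborel {t..T} (\<lambda>s. (1 + 1 / k) * (k * c)\<^sup>2)" by (intro set_integrable_continuous) simp
  have "(LINT s:{t..T}|lborel. (f' s - b (path_of y t f' s) s)\<^sup>2)
      \<le> (LINT s:{t..T}|lborel. (1 + k) * (v s)\<^sup>2 + (1 + 1 / k) * (k * c)\<^sup>2)"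
  proof (rule set_integral_mono_nonneg)
    fix s assume s: "s \<in> {t..T}"
    have "\<bar>b (path_of y t f s) s - b (path_of y t f' s) s\<bar> \<le> A * \<bar>path_of y t f s - path_of y t f' s\<bar>"
      by (rule drift_lipschitz[OF b]) (use s in auto)
    also have "\<dots> = A * ((s - t) * d)" unfolding path[OF s] using d s by simp
    also have "\<dots> \<le> A * (\<tau> * d)" using A d s by (intro mult_left_mono mult_right_mono) (auto simp: \<tau>_def)
    also have "\<dots> = A * (k * z)" using \<tau> by (simp add: d_def)
    finally have "\<bar>d + (b (path_of y t f s) s - b (path_of y t f' s) s)\<bar> \<le> k * c"
      using d by (simp add: c_def d_def algebra_simps)
    then have "(d + (b (path_of y t f s) s - b (path_of y t f' s) s))\<^sup>2 \<le> (k * c)\<^sup>2"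
      by (metis abs_ge_zero power2_abs power_mono)
    then have "(1 + 1 / k) * (d + (b (path_of y t f s) s - b (path_of y t f' s) s))\<^sup>2 \<le> (1 + 1 / k) * (k * c)\<^sup>2"
      using k by (intro mult_left_mono) auto
    moreover have eq: "f' s - b (path_of y t f' s) s = v s + (d + (b (path_of y t f s) s - b (path_of y t f' s) s))"
      by (simp add: f'_def' v_def)
    ultimately show "(f' s - b (path_of y t f' s) s)\<^sup>2 \<le> (1 + k) * (v s)\<^sup>2 + (1 + 1 / k) * (k * c)\<^sup>2"
      unfolding eq
      using weighted_square_sum_le[OF k, of "v s" "d + (b (path_of y t f s) s - b (path_of y t f' s) s)"] by linarith
  next
    show "set_integrable lborel {t..T} (\<lambda>s. (1 + k) * (v s)\<^sup>2 + (1 + 1 / k) * (k * c)\<^sup>2)"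
      by (intro set_integral_add(1) set_integrable_mult_right vi ci)
  qed (use k in auto)
  also have "\<dots> = (1 + k) * (LINT s:{t..T}|lborel. (v s)\<^sup>2) + (1 + 1 / k) * (k * c)\<^sup>2 * \<tau>"
  proof -
    have "(LINT s:{t..T}|lborel. (1 + 1 / k) * (k * c)\<^sup>2) = (1 + 1 / k) * (k * c)\<^sup>2 * \<tau>"
      using tT by (simp add: set_lebesgue_integral_def \<tau>_def mult.commute)
    then show ?thesis by (subst set_integral_add(2)) (auto intro!: set_integrable_mult_right vi ci simp only: set_integral_mult_right)
  qed
  also have "(1 + 1 / k) * (k * c)\<^sup>2 * \<tau> = (k + k\<^sup>2) * c\<^sup>2 * \<tau>"
    using k by (simp add: power2_eq_square field_simps)
  finally have "action b y t T f' \<le> 1 / 2 * ((1 + k) * (LINT s:{t..T}|lborel. (v s)\<^sup>2) + (k + k\<^sup>2) * c\<^sup>2 * \<tau>)"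
    unfolding action_def by (rule mult_left_mono) simp
  also have "\<dots> = (1 + k) * (1 / 2 * (LINT s:{t..T}|lborel. (v s)\<^sup>2)) + (k + k\<^sup>2) * c\<^sup>2 * \<tau> / 2"
    by (simp add: distrib_left)
  finally show "action b y t T f' \<le> (1 + k) * action b y t T f + (k + k\<^sup>2) * (z / (T - t) + A * z)\<^sup>2 * (T - t) / 2"
    unfolding action_def v_def c_def \<tau>_def .
qed

text \<open>With \<open>P = k (W - W t) - \<integral>v\<close> the difference \<open>D\<close> of the solution and the controlled path satisfies
\<open>D s = \<integral>\<alpha> + P s\<close> with \<open>\<bar>\<alpha>\<bar> \<le> A \<bar>D\<bar>\<close>. If \<open>P\<close> is of order \<open>k\<close> then so is \<open>D T\<close>, by Gronwall's
inequality, and the margin in the assumption \<open>reach\<close> forces \<open>Y T > x\<close>.\<close>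
lemma u_eps_lower_bound_of_control:
  assumes bm: "brownian_motion_on M t T W" and sol: "sde_solution M b \<epsilon> t T y W Y"
    and b: "drift_bound b T A" and A: "0 \<le> A" and by2: "L2_on t T (b y)" and tT: "t < T"
    and \<epsilon>: "0 < \<epsilon>" and f: "L2_on t T f"
  defines "m \<equiv> 12 * exp ((T - t + 1) / 2)"
  assumes reach: "x + sqrt \<epsilon> * m * (1 + A * exp (A * (T - t)) * (T - t)) < path_of y t f T"
    and K: "0 < K" "2 * action b y t T f \<le> \<epsilon> * K\<^sup>2"
  shows "exp (- K\<^sup>2 / 2 - K * m) / 2 \<le> u_eps M Y T x"
proof -
  interpret prob_space M using bm by (simp add: brownian_motion_on_def)
  define k where "k = sqrt \<epsilon>"
  have k: "0 < k" "k\<^sup>2 = \<epsilon>" using \<epsilon> by (auto simp: k_def)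
  have m: "0 < m" by (simp add: m_def)
  define z where "z = path_of y t f"
  have zc: "continuous_on {t..T} z" unfolding z_def using f by (rule continuous_on_path_of)
  define v where "v = (\<lambda>s. f s - b (z s) s)"
  have bz: "L2_on t T (\<lambda>s. b (z s) s)" by (rule L2_on_drift_along_path[OF b by2 zc])
  have v: "L2_on t T v" unfolding v_def by (rule L2_on_diff[OF f bz])
  have [measurable]: "Y T \<in> borel_measurable M" using sol tT by (simp add: sde_solution_def)
  have U: "{\<omega> \<in> space M. x < Y T \<omega>} \<in> sets M" by measurable
  have vK: "(LINT s:{t..T}|lborel. (v s)\<^sup>2) \<le> k\<^sup>2 * K\<^sup>2"
    using K(2) by (simp add: action_def v_def z_def k)
  have sde: "AE \<omega> in M. continuous_on {t..T} (\<lambda>s. Y s \<omega>) \<and>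
        set_integrable lborel {t..T} (\<lambda>r. b (Y r \<omega>) r) \<and>
        (\<forall>s\<in>{t..T}. Y s \<omega> = y + (LINT r:{t..s}|lborel. b (Y r \<omega>) r) + sqrt \<epsilon> * (W s \<omega> - W t \<omega>))"
    using sol by (simp add: sde_solution_def)
  have "exp (- K\<^sup>2 / 2 - K * m) / 2 \<le> prob {\<omega> \<in> space M. x < Y T \<omega>}"
    unfolding m_def
  proof (rule brownian_shifted_small_deviation[OF bm tT k(1) v K(1) vK U])
    show "AE \<omega> in M. continuous_on {t..T} (\<lambda>s. k * (W s \<omega> - W t \<omega>) - (LINT r:{t..s}|lborel. v r)) \<and>
        (LINT s:{t..T}|lborel. \<bar>k * (W s \<omega> - W t \<omega>) - (LINT r:{t..s}|lborel. v r)\<bar>) / (T - t)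
          + \<bar>k * (W T \<omega> - W t \<omega>) - (LINT r:{t..T}|lborel. v r)\<bar> \<le> k * (12 * exp ((T - t + 1) / 2))
        \<longrightarrow> \<omega> \<in> {\<omega> \<in> space M. x < Y T \<omega>}"
      using sde AE_space
    proof eventually_elim
      case (elim \<omega>)
      define P where "P = (\<lambda>s. k * (W s \<omega> - W t \<omega>) - (LINT r:{t..s}|lborel. v r))"
      define D where "D = (\<lambda>s. Y s \<omega> - z s)"
      define \<alpha> where "\<alpha> = (\<lambda>s. b (Y s \<omega>) s - b (z s) s)"
      define J where "J = (LINT s:{t..T}|lborel. \<bar>P s\<bar>)"
      have bYi: "set_integrable lborel {t..T} (\<lambda>s. b (Y s \<omega>) s)" using elim(1) by blast
      have \<alpha>i: "set_integrable lborel {t..T} \<alpha>"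
        unfolding \<alpha>_def using bYi L2_on_imp_set_integrable[OF bz] by (rule set_integral_diff)
      have J0: "0 \<le> J" unfolding J_def set_lebesgue_integral_def by (intro integral_nonneg_AE) simp
      have "x < Y T \<omega>" if Pc: "continuous_on {t..T} P" and small: "J / (T - t) + \<bar>P T\<bar> \<le> k * m"
      proof -
        have "\<bar>D T - P T\<bar> \<le> A * exp (A * (T - t)) * J"
          unfolding J_def
        proof (rule gronwall_linear_perturbation[OF Pc tT A _ \<alpha>i])
          show "continuous_on {t..T} D" unfolding D_def using elim(1) zc by (intro continuous_intros) auto
          show "\<bar>\<alpha> s\<bar> \<le> A * \<bar>D s\<bar>" if "s \<in> {t..T}" for s
            unfolding \<alpha>_def D_def by (rule drift_lipschitz[OF b]) (use that in simp)
          show "D s = (LINT r:{t..s}|lborel. \<alpha> r) + P s" if s: "s \<in> {t..T}" for s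
          proof -
            have i: "set_integrable lborel {t..s} (\<lambda>r. b (Y r \<omega>) r)" "set_integrable lborel {t..s} (\<lambda>r. b (z r) r)"
              "set_integrable lborel {t..s} f"
              using s by (auto intro: set_integrable_subset[OF bYi] set_integrable_subset[OF L2_on_imp_set_integrable[OF bz]]
                set_integrable_subset[OF L2_on_imp_set_integrable[OF f]])
            have "(LINT r:{t..s}|lborel. \<alpha> r) = (LINT r:{t..s}|lborel. b (Y r \<omega>) r) - (LINT r:{t..s}|lborel. b (z r) r)"
              unfolding \<alpha>_def by (rule set_integral_diff(2)[OF i(1,2)])
            moreover have "(LINT r:{t..s}|lborel. v r) = (LINT r:{t..s}|lborel. f r) - (LINT r:{t..s}|lborel. b (z r) r)"
              unfolding v_def by (rule set_integral_diff(2)[OF i(3,2)])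
            moreover have "z s = y + (LINT r:{t..s}|lborel. f r)" by (simp add: z_def path_of_def)
            moreover have "Y s \<omega> = y + (LINT r:{t..s}|lborel. b (Y r \<omega>) r) + k * (W s \<omega> - W t \<omega>)"
              using elim(1) s by (simp add: k_def)
            ultimately show ?thesis by (simp add: D_def P_def)
          qed
        qed
        also have "\<dots> \<le> A * exp (A * (T - t)) * (k * m * (T - t))"
        proof (rule mult_left_mono)
          have "J / (T - t) \<le> k * m" using small by linarith
          then show "J \<le> k * m * (T - t)" using tT by (simp add: field_simps)
        qed (use A in simp)
        finally have DP: "\<bar>D T - P T\<bar> \<le> k * m * (A * exp (A * (T - t)) * (T - t))" by (simp add: mult_ac)
        have "0 \<le> J / (T - t)" using J0 tT by simp
        then have "\<bar>P T\<bar> \<le> k * m" using small by linarith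
        then have "- (k * m * (1 + A * exp (A * (T - t)) * (T - t))) \<le> D T"
          using DP unfolding distrib_left mult_1_right by linarith
        then show ?thesis using reach by (simp add: D_def z_def k_def)
      qed
      then show ?case using elim(2) unfolding P_def J_def m_def by blast
    qed
  qed
  then show ?thesis by (simp add: u_eps_def)
qed

section \<open>Rate of convergence\<close>
lemma q_eps_eq_ln:
  assumes "0 < u_eps M Y T x" "0 < \<epsilon>"
  shows "q_eps M Y \<epsilon> T x = - \<epsilon> * ln (u_eps M Y T x)"
  unfolding q_eps_def
proof (rule the_equality)
  show "u_eps M Y T x = exp (- (- \<epsilon> * ln (u_eps M Y T x)) / \<epsilon>)" using assms by simp
  fix r assume "u_eps M Y T x = exp (- r / \<epsilon>)"
  then have "ln (u_eps M Y T x) = - r / \<epsilon>" by simp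
  then show "r = - \<epsilon> * ln (u_eps M Y T x)" using assms by (simp add: field_simps)
qed

text \<open>The margin demanded by \<open>u_eps_lower_bound_of_control\<close>, in units of \<open>sqrt \<epsilon>\<close> and for a time interval
of length \<open>\<tau>\<close>; the final \<open>1\<close> makes the inequality there strict.\<close>
definition overshoot :: "real \<Rightarrow> real \<Rightarrow> real" where
  "overshoot A \<tau> = 12 * exp ((\<tau> + 1) / 2) * (1 + A * exp (A * \<tau>) * \<tau>) + 1"

text \<open>If \<open>q_cost\<close> is at most \<open>Q\<close>, the action of the overshooting control exceeds \<open>q_cost\<close> by at most
\<open>action_excess A \<tau> Q * sqrt \<epsilon>\<close>.\<close>
definition action_excess :: "real \<Rightarrow> real \<Rightarrow> real \<Rightarrow> real" where
  "action_excess A \<tau> Q = Q + 2 + (overshoot A \<tau> / \<tau> + A * overshoot A \<tau>)\<^sup>2 * \<tau>"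

lemma u_eps_lower_bound:
  assumes bm: "brownian_motion_on M t T W" and sol: "sde_solution M b \<epsilon> t T y W Y"
    and b: "drift_bound b T A" and A: "0 \<le> A" and by2: "L2_on t T (b y)" and tT: "t < T"
    and \<epsilon>: "0 < \<epsilon>" "\<epsilon> < 1" and Q: "q_cost b T x y t \<le> Q"
  defines "C \<equiv> action_excess A (T - t) Q" and "m \<equiv> 12 * exp ((T - t + 1) / 2)"
  shows "exp (- (q_cost b T x y t + (C + m * sqrt (2 * (Q + C)) + 1) * sqrt \<epsilon>) / \<epsilon>) \<le> u_eps M Y T x"
proof -
  define \<tau> where "\<tau> = T - t"
  define k where "k = sqrt \<epsilon>"
  define q where "q = q_cost b T x y t"
  define z where "z = overshoot A \<tau>"
  define c where "c = (z / \<tau> + A * z)\<^sup>2 * \<tau>"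
  have \<tau>: "0 < \<tau>" using tT by (simp add: \<tau>_def)
  have k: "0 < k" "k < 1" "k\<^sup>2 = \<epsilon>" using \<epsilon> by (auto simp: k_def)
  have q: "0 \<le> q" "q \<le> Q" using q_cost_nonneg[OF tT] Q by (auto simp: q_def)
  have c: "0 \<le> c" using \<tau> by (simp add: c_def)
  have C: "C = Q + 2 + c" by (simp add: C_def action_excess_def c_def z_def \<tau>_def)
  have m: "0 < m" by (simp add: m_def)
  have z: "m * (1 + A * exp (A * \<tau>) * \<tau>) < z" "0 \<le> z"
  proof -
    show "m * (1 + A * exp (A * \<tau>) * \<tau>) < z" by (simp add: z_def overshoot_def m_def \<tau>_def)
    moreover have "0 \<le> m * (1 + A * exp (A * \<tau>) * \<tau>)" using m A \<tau> by simp
    ultimately show "0 \<le> z" by linarith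
  qed
  have kk: "k\<^sup>2 \<le> k" using mult_left_mono[of k 1 k] k(1,2) by (simp add: power2_eq_square)
  obtain f where f: "L2_on t T f" "x \<le> path_of y t f T" "action b y t T f < q + k"
    using exists_nearly_optimal_control[OF tT k(1), of x y b] unfolding q_def by blast
  define f' where "f' = (\<lambda>s. f s + k * z / (T - t))"
  note over = overshooting_control[OF b A by2 tT k(1) f(1) z(2), folded f'_def]
  \<comment> \<open>The bound \<open>a\<close> is used in place of the action itself because it is positive, so that \<open>K\<close> is.\<close>
  define a where "a = q + C * k"
  have C0: "0 < C" using q c C by linarith
  have "C * k \<le> C" "0 < C * k" using C0 k by (auto simp: mult_le_cancel_left1)
  then have a: "0 < a" "a \<le> Q + C" unfolding a_def using q by linarith+
  have "action b y t T f' \<le> (1 + k) * (q + k) + (k + k\<^sup>2) * c / 2"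
  proof -
    have "action b y t T f' \<le> (1 + k) * action b y t T f + (k + k\<^sup>2) * c / 2"
      using over(3) by (simp add: c_def \<tau>_def mult.assoc)
    also have "(1 + k) * action b y t T f \<le> (1 + k) * (q + k)" using f(3) k by (intro mult_left_mono) auto
    finally show ?thesis by simp
  qed
  also have "\<dots> \<le> a"
  proof -
    have "k * q \<le> k * Q" using k q by (intro mult_left_mono) auto
    moreover have "(k + k\<^sup>2) * c \<le> (2 * k) * c" using kk c by (intro mult_right_mono) auto
    moreover have "(1 + k) * (q + k) = q + k + k * q + k\<^sup>2" "a = q + (k * Q + 2 * k + k * c)"
      by (simp_all add: a_def C algebra_simps power2_eq_square)
    ultimately show ?thesis using kk by linarith
  qed
  finally have act: "action b y t T f' \<le> a" .
  define K where "K = sqrt (2 * a) / k"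
  have K: "0 < K" "\<epsilon> * K\<^sup>2 = 2 * a" using a k by (auto simp: K_def power_divide)
  have "exp (- K\<^sup>2 / 2 - K * m) / 2 \<le> u_eps M Y T x"
    unfolding m_def
  proof (rule u_eps_lower_bound_of_control[OF bm sol b A by2 tT \<epsilon>(1) over(1) _ K(1)])
    have "k * (m * (1 + A * exp (A * \<tau>) * \<tau>)) < k * z" using z k by simp
    then show "x + sqrt \<epsilon> * (12 * exp ((T - t + 1) / 2)) * (1 + A * exp (A * (T - t)) * (T - t)) < path_of y t f' T"
      using f(2) unfolding over(2) by (simp add: k_def m_def \<tau>_def mult.assoc)
    show "2 * action b y t T f' \<le> \<epsilon> * K\<^sup>2" using act K by simp
  qed
  moreover have "exp (- (q + (C + m * sqrt (2 * (Q + C)) + 1) * k) / \<epsilon>) \<le> exp (- K\<^sup>2 / 2 - K * m) / 2"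
  proof -
    have e1: "K\<^sup>2 / 2 = a / \<epsilon>" using K \<epsilon> by (simp add: field_simps)
    have "K = k * sqrt (2 * a) / \<epsilon>" using k by (simp add: K_def k(3)[symmetric] power2_eq_square)
    also have "\<dots> \<le> k * sqrt (2 * (Q + C)) / \<epsilon>"
      using a k \<epsilon> by (intro divide_right_mono mult_left_mono) auto
    finally have "K * m \<le> k * sqrt (2 * (Q + C)) / \<epsilon> * m" using m by (intro mult_right_mono) auto
    then have e2: "K * m \<le> m * sqrt (2 * (Q + C)) * k / \<epsilon>" by (simp add: mult_ac)
    \<comment> \<open>This absorbs the factor \<open>1/2\<close> in front of the exponential.\<close>
    have "ln 2 * \<epsilon> \<le> 1 * k" using ln_2_less_1 kk k \<epsilon> by (intro mult_mono) auto
    then have e3: "ln 2 \<le> k / \<epsilon>" using \<epsilon> by (simp add: field_simps)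
    have "- (q + (C + m * sqrt (2 * (Q + C)) + 1) * k) / \<epsilon> = - (a / \<epsilon>) - m * sqrt (2 * (Q + C)) * k / \<epsilon> - k / \<epsilon>"
      by (simp add: a_def add_divide_distrib diff_divide_distrib algebra_simps)
    also have "\<dots> \<le> - K\<^sup>2 / 2 - K * m - ln 2" using e1 e2 e3 by simp
    finally have "exp (- (q + (C + m * sqrt (2 * (Q + C)) + 1) * k) / \<epsilon>) \<le> exp (- K\<^sup>2 / 2 - K * m - ln 2)" by simp
    also have "\<dots> = exp (- K\<^sup>2 / 2 - K * m) / 2" by (simp add: exp_diff)
    finally show ?thesis .
  qed
  ultimately show ?thesis by (simp add: q_def k_def)
qed

lemma log_u_eps_upper_bound:
  assumes bm: "brownian_motion_on M t T W" and sol: "sde_solution M b \<epsilon> t T y W Y"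
    and b: "drift_bound b T A" and A: "0 \<le> A" and by2: "L2_on t T (b y)" and tT: "t < T"
    and \<epsilon>: "0 < \<epsilon>" "\<epsilon> < 1" and Q: "q_cost b T x y t \<le> Q" and u: "0 < u_eps M Y T x"
  shows "\<epsilon> * ln (u_eps M Y T x) \<le> - q_cost b T x y t + (Q + 2 * (A * (T - t) + 2)) * sqrt \<epsilon>"
proof -
  define \<tau> where "\<tau> = T - t"
  define k where "k = sqrt \<epsilon>"
  define l where "l = sqrt k"
  define q where "q = q_cost b T x y t"
  have \<tau>: "0 < \<tau>" using tT by (simp add: \<tau>_def)
  have k: "0 < k" "k < 1" "k\<^sup>2 = \<epsilon>" using \<epsilon> by (auto simp: k_def)
  have l: "0 < l" "l < 1" "l\<^sup>2 = k" using k by (auto simp: l_def)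
  \<comment> \<open>The fewest blocks, up to a constant, for which \<open>A * h \<le> \<epsilon> powr (1/4) = l\<close>.\<close>
  define N where "N = nat \<lceil>A * \<tau> / l\<rceil> + 1"
  have At: "0 \<le> A * \<tau> / l" using A \<tau> l by simp
  have N: "A * \<tau> / l \<le> real N" "real N \<le> A * \<tau> / l + 2" "0 < N"
    unfolding N_def using At by linarith+
  define h where "h = \<tau> / real N"
  have h: "0 < h" "real N * h = T - t" using N \<tau> by (auto simp: h_def \<tau>_def)
  have "A * h \<le> l" using N l by (simp add: h_def field_simps)
  then have "(A * h)\<^sup>2 \<le> l\<^sup>2" using A h by (intro power_mono) auto
  then have "A\<^sup>2 * h\<^sup>2 \<le> k" unfolding power_mult_distrib l(3) .
  then have Ah: "A\<^sup>2 * h\<^sup>2 \<le> 2 * sqrt \<epsilon>" using k(1) unfolding k_def by linarith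
  have "ln (u_eps M Y T x) \<le> ln (sqrt (2 / \<epsilon>) ^ N * exp (- (1 - sqrt \<epsilon>) * q / \<epsilon>))"
    using u_eps_upper_bound[OF bm sol b A by2 tT \<epsilon> h Ah, of x] u unfolding q_def by simp
  also have "\<dots> = real N * (ln (2 / \<epsilon>) / 2) + - (1 - k) * q / \<epsilon>"
    using \<epsilon> by (simp add: ln_mult ln_realpow ln_sqrt k_def)
  finally have "\<epsilon> * ln (u_eps M Y T x) \<le> \<epsilon> * (real N * (ln (2 / \<epsilon>) / 2) + - (1 - k) * q / \<epsilon>)"
    using \<epsilon> by (intro mult_left_mono) auto
  also have "\<dots> = \<epsilon> * real N * (ln (2 / \<epsilon>) / 2) - q + k * q"
    using \<epsilon> by (simp add: field_simps)
  also have "\<epsilon> * real N * (ln (2 / \<epsilon>) / 2) \<le> 2 * (A * \<tau> + 2) * k"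
  proof -
    have el: "\<epsilon> = l ^ 4" using k l by (metis power2_eq_square power4_eq_xxxx mult.assoc)
    have "ln (2 / \<epsilon>) = ln 2 - 4 * ln l" using l by (simp add: el ln_div ln_realpow)
    also have "- ln l \<le> 1 / l - 1" using ln_le_minus_one[of "1 / l"] l by (simp add: ln_div)
    then have "ln 2 - 4 * ln l \<le> 4 / l" using ln_2_less_1 by simp
    finally have ln: "ln (2 / \<epsilon>) / 2 \<le> 2 / l" by simp
    have "A * \<tau> / l + 2 \<le> A * \<tau> / l + 2 / l" using l(1,2) by (simp add: le_divide_eq)
    then have Nl: "real N \<le> (A * \<tau> + 2) / l" using N by (simp add: add_divide_distrib)
    have "0 \<le> ln (2 / \<epsilon>) / 2" using \<epsilon> by simp
    then have "real N * (ln (2 / \<epsilon>) / 2) \<le> (A * \<tau> + 2) / l * (2 / l)"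
      using Nl ln A \<tau> l by (intro mult_mono) auto
    then have "\<epsilon> * (real N * (ln (2 / \<epsilon>) / 2)) \<le> l ^ 4 * ((A * \<tau> + 2) / l * (2 / l))"
      using \<epsilon> unfolding el by (intro mult_left_mono) auto
    also have "\<dots> = 2 * (A * \<tau> + 2) * k"
      using l(1) by (simp add: l(3)[symmetric] power2_eq_square power4_eq_xxxx)
    finally show ?thesis by (simp add: mult.assoc)
  qed
  also have "k * q \<le> k * Q" using k Q by (intro mult_left_mono) (auto simp: q_def)
  finally show ?thesis by (simp add: q_def k_def \<tau>_def algebra_simps)
qed

theorem theorem1p1:
  fixes T A x y t :: real
  assumes "T > 0" and "A \<ge> 0" and "t < T"
  shows "\<exists>C :: real \<Rightarrow> real.
    \<forall>(b :: real \<Rightarrow> real \<Rightarrow> real) (\<epsilon> :: real) (M :: 'a measure) W Y.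
      drift_bound b T A \<and> L2_on t T (b y) \<and> 0 < \<epsilon> \<and> \<epsilon> < 1 \<and>
      brownian_motion_on M t T W \<and> sde_solution M b \<epsilon> t T y W Y
      \<longrightarrow> \<bar>q_eps M Y \<epsilon> T x - q_cost b T x y t\<bar> \<le> C (L2_norm_on t T (b y)) * sqrt \<epsilon>"
proof -
  define Q where "Q = cost_bound A x y t T"
  define E where "E = (\<lambda>\<rho>. action_excess A (T - t) (Q \<rho>))"
  define U where "U = (\<lambda>\<rho>. E \<rho> + 12 * exp ((T - t + 1) / 2) * sqrt (2 * (Q \<rho> + E \<rho>)) + 1)"
  define L where "L = (\<lambda>\<rho>. Q \<rho> + 2 * (A * (T - t) + 2))"
  have "\<bar>q_eps M Y \<epsilon> T x - q_cost b T x y t\<bar> \<le> max (U (L2_norm_on t T (b y))) (L (L2_norm_on t T (b y))) * sqrt \<epsilon>"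
    if H: "drift_bound b T A" "L2_on t T (b y)" "0 < \<epsilon>" "\<epsilon> < 1"
      "brownian_motion_on M t T W" "sde_solution M b \<epsilon> t T y W Y" for b \<epsilon> W Y and M :: "'a measure"
  proof -
    define \<rho> where "\<rho> = L2_norm_on t T (b y)"
    define q where "q = q_cost b T x y t"
    define u where "u = u_eps M Y T x"
    have qQ: "q_cost b T x y t \<le> Q \<rho>"
      unfolding Q_def \<rho>_def by (rule q_cost_le_cost_bound[OF H(1,2) assms(3,2)])
    have lower: "exp (- (q + U \<rho> * sqrt \<epsilon>) / \<epsilon>) \<le> u"
      using u_eps_lower_bound[OF H(5,6,1) assms(2) H(2) assms(3) H(3,4) qQ]
      by (simp add: u_def q_def U_def E_def)
    have u0: "0 < u" using lower exp_gt_zero by (rule less_le_trans[rotated])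
    have "- (q + U \<rho> * sqrt \<epsilon>) / \<epsilon> \<le> ln u" using lower u0 by (simp add: ln_ge_iff)
    then have 1: "- \<epsilon> * ln u - q \<le> U \<rho> * sqrt \<epsilon>" using H(3) by (simp add: field_simps)
    have 2: "\<epsilon> * ln u \<le> - q + L \<rho> * sqrt \<epsilon>"
      using log_u_eps_upper_bound[OF H(5,6,1) assms(2) H(2) assms(3) H(3,4) qQ] u0
      by (simp add: u_def q_def L_def)
    have "U \<rho> * sqrt \<epsilon> \<le> max (U \<rho>) (L \<rho>) * sqrt \<epsilon>" "L \<rho> * sqrt \<epsilon> \<le> max (U \<rho>) (L \<rho>) * sqrt \<epsilon>"
      using H(3) by (auto intro: mult_right_mono)
    then have "\<bar>- \<epsilon> * ln u - q\<bar> \<le> max (U \<rho>) (L \<rho>) * sqrt \<epsilon>" using 1 2 by (simp add: abs_le_iff)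
    then show ?thesis
      using q_eps_eq_ln[of M Y T x \<epsilon>] u0 H(3) by (simp add: u_def q_def \<rho>_def)
  qed
  then show ?thesis by (intro exI[of _ "\<lambda>\<rho>. max (U \<rho>) (L \<rho>)"]) blast
qed

end
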